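(* Let $X$ be a finite connected symmetric digraph with all $d_v\ge1$ and a voltage assignment $\alpha:E(X)\to\Gamma\simeq\mathbb Z_p^d$. Let $\pi:Y\to X$ be a finite connected unramified Galois cover with Galois group $G$, and assume that $G$ is a finite $p$-group; equip $Y$ with the pullback weight and the pullback voltage assignment $\alpha\circ\pi_E$. Let $K/\mathbb Q_p$ be a finite extension containing all weights and over which $G$ splits. Let $P(A)\in\mathcal O_K[A]$ be monic. Assume \[ w(e)=\frac{2}{d_{o(e)}}\in\mathcal O_K\qquad(e\in E(X)), \] and assume also that $\mathcal R_{X,P}\neq0$ and $\mathcal R_{Y,P}\neq0$. Then \[ \mu(\mathcal R_{X,P})=0\iff\mu(\mathcal R_{Y,P})=0 . \] Moreover, if this equivalent condition holds, then \[ \lambda(\mathcal R_{Y,P})=[Y:X]\,\lambda(\mathcal R_{X,P}). \]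
   Context: Let $p$ be a prime and $d\ge1$. For a finite extension $K/\mathbb Q_p$ let $\mathcal O_K$ be its valuation ring, $\varpi$ a uniformizer, $k$ the residue field, $e(K/\mathbb Q_p)$ the ramification index. "$G$ splits over $K$" means $K$ is a splitting field for $G$. Graphs. A finite symmetric digraph $X$ has a finite vertex set $V(X)=\{v_1,\dots,v_m\}$ and a finite set $E(X)$ of directed edges (loops and multiple edges allowed) with origin $o(e)$, terminus $t(e)$ and an inversion $e\mapsto\bar e\ne e$ with $\bar{\bar e}=e$, $o(\bar e)=t(e)$. Put $d_v=\#\{e:o(e)=v\}$ and let $w(e)=2/d_{o(e)}$ be the Grover weight. A voltage assignment into $\Gamma\simeq\mathbb Z_p^d$ satisfies $\alpha(\bar e)=-\alpha(e)$. Cover. Write $Y=X(G,\beta)$ with $\beta:E(X)\to G$, $\beta(\bar e)=\beta(e)^{-1}$: $V(Y)=V(X)\times G$, with directed edges $(e,g):(o(e),g)\to(t(e),g\beta(e))$ for $e\in E(X),g\in G$. $\pi_E:E(Y)\to E(X)$ is $(e,g)\mapsto e$; $[Y:X]=|G|$. The weight on $Y$ is $w(\tilde e)=w(\pi_E(\tilde e))$ and the voltage assignment on $Y$ is $\alpha\circ\pi_E$. Spectral polynomial. For $\gamma\in\Gamma\simeq\mathbb Z_p^d$ put $\tau(\gamma)=\prod_i(1+T_i)^{\gamma_i}\in\mathbb Z_p[[T_1,\dots,T_d]]$. For a weighted voltage digraph $Z\in\{X,Y\}$ let $W^Z$ be the matrix indexed by $V(Z)$ with $(u,v)$ entry $\sum_{e:u\to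 v}w(e)\tau(\text{voltage of }e)$, and $\mathcal F_Z(A,T)=\det\bigl(A^2I-AW^Z+D^W(Z)-I\bigr)$ with $D^W(Z)=\operatorname{diag}\bigl(\sum_{o(e)=v}w(e)\bigr)_v=2I$; it is monic in $A$. Resultants: for monic $f=\prod_i(A-\alpha_i)$ over an algebraically closed field, $\operatorname{Res}_A(f,g)=\prod_ig(\alpha_i)$. Put $\mathcal R_{Z,P}(T)=\operatorname{Res}_A(\mathcal F_Z(A,T),P(A))\in K[[T_1,\dots,T_d]]$. Iwasawa invariants. If a nonzero $F\in K[[T_1,\dots,T_d]]$ is written $F=\varpi^NF_0$ with $N\in\mathbb Z$, $F_0\in\mathcal O_K[[T_1,\dots,T_d]]$, $\varpi\nmid F_0$ (possible for the series here), then $\mu(F)=N/e(K/\mathbb Q_p)$ and $\lambda(F)=\sum_{\mathfrak p}\operatorname{ord}_{\mathfrak p}(\overline F_0)$, where $\overline F_0$ is the reduction in $k[[T_1,\dots,T_d]]$ and $\mathfrak p$ runs over the distinct height-one primes of the form $(\tau(\sigma)-1)$, $\sigma\in\Gamma\setminus p\Gamma$, dividing $\overline F_0$. *)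

theory Defs
  imports
    "HOL-Algebra.Algebraic_Closure_Type"
    "HOL-Computational_Algebra.Computational_Algebra"
    "Berlekamp_Zassenhaus.Finite_Field"
    "Subresultants.Resultant_Prelim"
    "Graph_Theory.Graph_Theory"
begin

section \<open>The ring of p-adic integers and the field of p-adic numbers\<close>

text \<open>
  The prime is p = CARD('p), with 'p of class \<^class>\<open>prime_card\<close>.  A p-adic integer is
  a coherent sequence of residues, the n-th one being the canonical representative modulo
  the n-th power of p; this is the inverse limit of the rings Z/p^n.
\<close>

typedef 'p padic_int =
  "{x :: nat \<Rightarrow> int. \<forall>n. x n \<in> {0..<int CARD('p::prime_card) ^ n}
       \<and> x (Suc n) mod int CARD('p) ^ n = x n}"
  morphisms padic_res Abs_padic_int
proof
  have "0 < CARD('p)" by (simp add: finite_UNIV_card_ge_0 card_gt_0_iff)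
  then show "(\<lambda>_. 0) \<in> {x :: nat \<Rightarrow> int. \<forall>n. x n \<in> {0..<int CARD('p) ^ n}
       \<and> x (Suc n) mod int CARD('p) ^ n = x n}" by simp
qed

lemma p_pos: "0 < int CARD('p::prime_card)"
  using prime_card_int[where 'a='p] by (simp add: prime_gt_0_int)

lemma padic_res_ge: "0 \<le> padic_res (x::'p::prime_card padic_int) n"
  and padic_res_less: "padic_res x n < int CARD('p) ^ n"
  and padic_res_Suc: "padic_res x (Suc n) mod int CARD('p) ^ n = padic_res x n"
  using padic_res[of x] by auto

lemma padic_res_mod: "padic_res (x::'p::prime_card padic_int) n mod int CARD('p) ^ n = padic_res x n"
  using padic_res_ge[of x n] padic_res_less[of x n] by simp

lemma padic_res_mod_le:
  "n \<le> m \<Longrightarrow> padic_res (x::'p::prime_card padic_int) m mod int CARD('p) ^ n = padic_res x n"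
proof (induction m rule: dec_induct)
  case base
  show ?case by (rule padic_res_mod)
next
  case (step m)
  have "padic_res x (Suc m) mod int CARD('p) ^ n
      = padic_res x (Suc m) mod int CARD('p) ^ m mod int CARD('p) ^ n"
    using step.hyps(1) by (simp add: mod_mod_cancel le_imp_power_dvd)
  then show ?case by (simp add: padic_res_Suc step.IH)
qed

lemma padic_int_eqI: "(\<And>n. padic_res x n = padic_res y n) \<Longrightarrow> x = y"
  by (simp add: padic_res_inject[symmetric] fun_eq_iff)

lemma padic_res_Abs:
  assumes "\<And>n. f (Suc n) mod int CARD('p::prime_card) ^ n = f n mod int CARD('p) ^ n"
  shows "padic_res (Abs_padic_int (\<lambda>n. f n mod int CARD('p) ^ n) :: 'p padic_int) n
       = f n mod int CARD('p) ^ n"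
proof (subst Abs_padic_int_inverse)
  have "f (Suc n) mod int CARD('p) ^ Suc n mod int CARD('p) ^ n = f n mod int CARD('p) ^ n" for n
    using assms[of n] by (simp add: mod_mod_cancel)
  then show "(\<lambda>n. f n mod int CARD('p) ^ n) \<in> {x. \<forall>n. x n \<in> {0..<int CARD('p) ^ n}
       \<and> x (Suc n) mod int CARD('p) ^ n = x n}"
    using p_pos[where 'p='p] by simp
qed simp

instantiation padic_int :: (prime_card) comm_ring_1
begin

definition zero_padic_int :: "'a padic_int" where
  "0 = Abs_padic_int (\<lambda>n. 0 mod int CARD('a) ^ n)"
definition one_padic_int :: "'a padic_int" where
  "1 = Abs_padic_int (\<lambda>n. 1 mod int CARD('a) ^ n)"
definition plus_padic_int :: "'a padic_int \<Rightarrow> 'a padic_int \<Rightarrow> 'a padic_int" where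
  "x + y = Abs_padic_int (\<lambda>n. (padic_res x n + padic_res y n) mod int CARD('a) ^ n)"
definition minus_padic_int :: "'a padic_int \<Rightarrow> 'a padic_int \<Rightarrow> 'a padic_int" where
  "x - y = Abs_padic_int (\<lambda>n. (padic_res x n - padic_res y n) mod int CARD('a) ^ n)"
definition uminus_padic_int :: "'a padic_int \<Rightarrow> 'a padic_int" where
  "- x = Abs_padic_int (\<lambda>n. (- padic_res x n) mod int CARD('a) ^ n)"
definition times_padic_int :: "'a padic_int \<Rightarrow> 'a padic_int \<Rightarrow> 'a padic_int" where
  "x * y = Abs_padic_int (\<lambda>n. (padic_res x n * padic_res y n) mod int CARD('a) ^ n)"

lemma padic_res_0 [simp]: "padic_res (0 :: 'a padic_int) n = 0"
  unfolding zero_padic_int_def by (subst padic_res_Abs) auto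

lemma padic_res_1: "padic_res (1 :: 'a padic_int) n = 1 mod int CARD('a) ^ n"
  unfolding one_padic_int_def by (subst padic_res_Abs) auto

lemma padic_res_add:
  "padic_res (x + y :: 'a padic_int) n = (padic_res x n + padic_res y n) mod int CARD('a) ^ n"
  unfolding plus_padic_int_def
  by (subst padic_res_Abs) (metis mod_add_eq padic_res_Suc, simp)

lemma padic_res_diff:
  "padic_res (x - y :: 'a padic_int) n = (padic_res x n - padic_res y n) mod int CARD('a) ^ n"
  unfolding minus_padic_int_def
  by (subst padic_res_Abs) (metis mod_diff_eq padic_res_Suc, simp)

lemma padic_res_uminus:
  "padic_res (- x :: 'a padic_int) n = (- padic_res x n) mod int CARD('a) ^ n"
  unfolding uminus_padic_int_def
  by (subst padic_res_Abs) (metis mod_minus_eq padic_res_Suc, simp)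

lemma padic_res_mult:
  "padic_res (x * y :: 'a padic_int) n = (padic_res x n * padic_res y n) mod int CARD('a) ^ n"
  unfolding times_padic_int_def
  by (subst padic_res_Abs) (metis mod_mult_eq padic_res_Suc, simp)

instance
proof
  fix a b c :: "'a padic_int"
  show "a * b * c = a * (b * c)"
    by (rule padic_int_eqI) (simp add: padic_res_mult mod_simps mult.assoc)
  show "a * b = b * a"
    by (rule padic_int_eqI) (simp add: padic_res_mult mult.commute)
  show "1 * a = a"
    by (rule padic_int_eqI) (simp add: padic_res_mult padic_res_1 mod_simps padic_res_mod)
  show "a + b + c = a + (b + c)"
    by (rule padic_int_eqI) (simp add: padic_res_add mod_simps add.assoc)
  show "a + b = b + a"
    by (rule padic_int_eqI) (simp add: padic_res_add add.commute)
  show "0 + a = a"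
    by (rule padic_int_eqI) (simp add: padic_res_add padic_res_mod)
  show "- a + a = 0"
    by (rule padic_int_eqI) (simp add: padic_res_add padic_res_uminus mod_simps)
  show "a - b = a + - b"
    by (rule padic_int_eqI) (simp add: padic_res_add padic_res_diff padic_res_uminus mod_simps)
  show "(a + b) * c = a * c + b * c"
    by (rule padic_int_eqI) (simp add: padic_res_add padic_res_mult mod_simps distrib_right)
  have "1 < int CARD('a)"
    using prime_card_int[where 'a='a] by (rule prime_gt_1_int)
  then have "padic_res (1 :: 'a padic_int) 1 \<noteq> padic_res 0 1"
    by (simp add: padic_res_1)
  then show "(0 :: 'a padic_int) \<noteq> 1" by metis
qed

end

instance padic_int :: (prime_card) idom
proof
  fix a b :: "'a padic_int"
  let ?p = "int CARD('a)"
  assume "a \<noteq> 0" "b \<noteq> 0"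
  then obtain m n where mn: "padic_res a m \<noteq> 0" "padic_res b n \<noteq> 0"
    by (metis padic_int_eqI padic_res_0)
  let ?A = "padic_res a (m + n)" and ?B = "padic_res b (m + n)"
  have A: "\<not> ?p ^ m dvd ?A" and B: "\<not> ?p ^ n dvd ?B"
    using mn padic_res_mod_le[of m "m + n" a] padic_res_mod_le[of n "m + n" b]
    by (simp_all add: dvd_eq_mod_eq_0)
  have pr: "prime_elem ?p" using prime_card_int[where 'a='a] by simp
  have "\<not> ?p ^ (m + n) dvd ?A * ?B"
  proof
    assume d: "?p ^ (m + n) dvd ?A * ?B"
    have 0: "?A \<noteq> 0" "?B \<noteq> 0" using A B by auto
    have u: "\<not> is_unit ?p" using pr by (auto simp: prime_elem_def)
    have "multiplicity ?p ?A < m" "multiplicity ?p ?B < n"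
      using A B 0 u by (simp_all add: power_dvd_iff_le_multiplicity not_le)
    moreover have "m + n \<le> multiplicity ?p (?A * ?B)"
      using d 0 u by (simp add: power_dvd_iff_le_multiplicity)
    ultimately show False
      using prime_elem_multiplicity_mult_distrib[OF pr 0] by simp
  qed
  then have "padic_res (a * b) (m + n) \<noteq> 0"
    by (simp add: padic_res_mult dvd_eq_mod_eq_0)
  then show "a * b \<noteq> 0" by auto
qed

type_synonym 'p padic = "'p padic_int fract"

definition padic_abs :: "'p::prime_card padic_int \<Rightarrow> real" where
  "padic_abs x = (if x = 0 then 0
     else (1 / real CARD('p)) ^ (LEAST n. padic_res x (Suc n) \<noteq> 0))"


section \<open>Finite extensions of the field of p-adic numbers\<close>

text \<open>
  A finite extension K is a type 'k together with an embedding \<open>\<iota>\<close> of the p-adic numbers;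
  \<open>v\<close> is the (unique) absolute value on K extending the p-adic one.
\<close>

definition finite_extension_Qp :: "('p::prime_card padic \<Rightarrow> 'k::field) \<Rightarrow> bool" where
  "finite_extension_Qp \<iota> \<longleftrightarrow>
     field_hom \<iota> \<and> (\<exists>B. finite B \<and> module.span (\<lambda>q x. \<iota> q * x) B = UNIV)"

definition extends_padic_abs :: "('p::prime_card padic \<Rightarrow> 'k::field) \<Rightarrow> ('k \<Rightarrow> real) \<Rightarrow> bool" where
  "extends_padic_abs \<iota> v \<longleftrightarrow>
     (\<forall>x. v x \<ge> 0) \<and> (\<forall>x. v x = 0 \<longleftrightarrow> x = 0) \<and> (\<forall>x y. v (x * y) = v x * v y)
     \<and> (\<forall>x y. v (x + y) \<le> max (v x) (v y))
     \<and> (\<forall>z. v (\<iota> (to_fract z)) = padic_abs z)"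

definition valuation_ring :: "('k::field \<Rightarrow> real) \<Rightarrow> 'k set" where
  "valuation_ring v = {x. v x \<le> 1}"

definition uniformizer :: "('k::field \<Rightarrow> real) \<Rightarrow> 'k \<Rightarrow> bool" where
  "uniformizer v \<pi> \<longleftrightarrow>
     \<pi> \<noteq> 0 \<and> {x. v x < 1} = {\<pi> * y | y. y \<in> valuation_ring v}"

text \<open>
  The residue field is a type 'r with a reduction map: a surjective ring homomorphism from the
  valuation ring whose kernel is the maximal ideal.  The values of \<open>red\<close> outside the
  valuation ring are irrelevant.
\<close>

definition reduction_map :: "('k::field \<Rightarrow> real) \<Rightarrow> ('k \<Rightarrow> 'r::field) \<Rightarrow> bool" where
  "reduction_map v red \<longleftrightarrow>
     red 1 = 1
     \<and> (\<forall>x\<in>valuation_ring v. \<forall>y\<in>valuation_ring v.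
          red (x + y) = red x + red y \<and> red (x * y) = red x * red y)
     \<and> red ` valuation_ring v = UNIV
     \<and> (\<forall>x\<in>valuation_ring v. red x = 0 \<longleftrightarrow> v x < 1)"

definition ramification_index :: "nat \<Rightarrow> ('k::field \<Rightarrow> real) \<Rightarrow> 'k \<Rightarrow> nat" where
  "ramification_index p v \<pi> = (THE e. v (of_nat p) = v \<pi> ^ e)"


section \<open>Splitting fields of a finite group\<close>

definition matrix_rep ::
  "('g, 'm) monoid_scheme \<Rightarrow> nat \<Rightarrow> ('g \<Rightarrow> 'a::field mat) \<Rightarrow> bool" where
  "matrix_rep G n \<rho> \<longleftrightarrow>
     (\<forall>g\<in>carrier G. \<rho> g \<in> carrier_mat n n)
     \<and> \<rho> \<one>\<^bsub>G\<^esub> = 1\<^sub>m n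
     \<and> (\<forall>g\<in>carrier G. \<forall>h\<in>carrier G. \<rho> (g \<otimes>\<^bsub>G\<^esub> h) = \<rho> g * \<rho> h)"

definition invariant_subspace ::
  "('g, 'm) monoid_scheme \<Rightarrow> nat \<Rightarrow> ('g \<Rightarrow> 'a::field mat) \<Rightarrow> 'a vec set \<Rightarrow> bool" where
  "invariant_subspace G n \<rho> U \<longleftrightarrow>
     U \<subseteq> carrier_vec n \<and> 0\<^sub>v n \<in> U
     \<and> (\<forall>x\<in>U. \<forall>y\<in>U. x + y \<in> U) \<and> (\<forall>c. \<forall>x\<in>U. c \<cdot>\<^sub>v x \<in> U)
     \<and> (\<forall>g\<in>carrier G. \<forall>x\<in>U. \<rho> g *\<^sub>v x \<in> U)"

definition irreducible_rep ::
  "('g, 'm) monoid_scheme \<Rightarrow> nat \<Rightarrow> ('g \<Rightarrow> 'a::field mat) \<Rightarrow> bool" where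
  "irreducible_rep G n \<rho> \<longleftrightarrow>
     matrix_rep G n \<rho> \<and> n > 0
     \<and> (\<forall>U. invariant_subspace G n \<rho> U \<longrightarrow> U = {0\<^sub>v n} \<or> U = carrier_vec n)"

text \<open>K is a splitting field for G if every irreducible K-representation is absolutely irreducible.\<close>

definition splitting_field :: "'k::field itself \<Rightarrow> ('g, 'm) monoid_scheme \<Rightarrow> bool" where
  "splitting_field _ G \<longleftrightarrow>
     (\<forall>n (\<rho> :: 'g \<Rightarrow> 'k mat). irreducible_rep G n \<rho>
        \<longrightarrow> irreducible_rep G n (\<lambda>g. map_mat to_ac (\<rho> g)))"


section \<open>Formal power series in finitely many variables\<close>

text \<open>The variables are indexed by 'd, so their number is d = CARD('d); coefficients are
  indexed by exponent vectors.\<close>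

typedef ('d, 'a) mps = "UNIV :: (('d \<Rightarrow> nat) \<Rightarrow> 'a) set"
  morphisms mps_coeff Abs_mps by simp

lemma mps_coeff_Abs [simp]: "mps_coeff (Abs_mps f) = f"
  by (simp add: Abs_mps_inverse)

lemma mps_eqI: "(\<And>n. mps_coeff x n = mps_coeff y n) \<Longrightarrow> x = y"
  by (simp add: mps_coeff_inject[symmetric] fun_eq_iff)

definition exp_splits :: "('d \<Rightarrow> nat) \<Rightarrow> (('d \<Rightarrow> nat) \<times> ('d \<Rightarrow> nat)) set" where
  "exp_splits n = {(i, j). \<forall>x. i x + j x = n x}"

lemma finite_exp_splits [simp]: "finite (exp_splits (n :: 'd::finite \<Rightarrow> nat))"
proof (rule finite_subset)
  have "finite (PiE UNIV (\<lambda>x. {..n x}))" by (rule finite_PiE) auto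
  then have "finite {i :: 'd \<Rightarrow> nat. \<forall>x. i x \<le> n x}"
    by (rule finite_subset[rotated]) auto
  then show "finite ({i. \<forall>x. i x \<le> n x} \<times> {i. \<forall>x. i x \<le> n x})" by simp
  show "exp_splits n \<subseteq> {i. \<forall>x. i x \<le> n x} \<times> {i. \<forall>x. i x \<le> n x}"
    by (auto simp: exp_splits_def) (metis le_add1, metis le_add2)
qed

instantiation mps :: (finite, comm_ring_1) comm_ring_1
begin

definition zero_mps :: "('a, 'b) mps" where "0 = Abs_mps (\<lambda>_. 0)"
definition one_mps :: "('a, 'b) mps" where "1 = Abs_mps (\<lambda>n. if n = (\<lambda>_. 0) then 1 else 0)"
definition plus_mps :: "('a, 'b) mps \<Rightarrow> ('a, 'b) mps \<Rightarrow> ('a, 'b) mps" where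
  "f + g = Abs_mps (\<lambda>n. mps_coeff f n + mps_coeff g n)"
definition minus_mps :: "('a, 'b) mps \<Rightarrow> ('a, 'b) mps \<Rightarrow> ('a, 'b) mps" where
  "f - g = Abs_mps (\<lambda>n. mps_coeff f n - mps_coeff g n)"
definition uminus_mps :: "('a, 'b) mps \<Rightarrow> ('a, 'b) mps" where
  "- f = Abs_mps (\<lambda>n. - mps_coeff f n)"
definition times_mps :: "('a, 'b) mps \<Rightarrow> ('a, 'b) mps \<Rightarrow> ('a, 'b) mps" where
  "f * g = Abs_mps (\<lambda>n. \<Sum>(i, j)\<in>exp_splits n. mps_coeff f i * mps_coeff g j)"

instance
proof
  fix a b c :: "('a, 'b) mps"
  show "a * b * c = a * (b * c)"
  proof (rule mps_eqI)
    fix n :: "'a \<Rightarrow> nat"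
    have "mps_coeff (a * b * c) n = (\<Sum>(m, k)\<in>exp_splits n. \<Sum>(i, j)\<in>exp_splits m.
            mps_coeff a i * mps_coeff b j * mps_coeff c k)"
      by (simp add: times_mps_def sum_distrib_right case_prod_unfold)
    also have "\<dots> = (\<Sum>((m, k), (i, j))\<in>Sigma (exp_splits n) (\<lambda>(m, k). exp_splits m).
            mps_coeff a i * mps_coeff b j * mps_coeff c k)"
      by (subst sum.Sigma[symmetric]) (auto simp: case_prod_unfold)
    also have "\<dots> = (\<Sum>((i, l), (j, k))\<in>Sigma (exp_splits n) (\<lambda>(i, l). exp_splits l).
            mps_coeff a i * (mps_coeff b j * mps_coeff c k))"
      by (rule sum.reindex_bij_witness
            [where i = "\<lambda>((i, l), (j, k)). ((\<lambda>x. i x + j x, k), (i, j))"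
               and j = "\<lambda>((m, k), (i, j)). ((i, \<lambda>x. j x + k x), (j, k))"])
         (auto simp: exp_splits_def fun_eq_iff mult.assoc add.assoc[symmetric], (metis add.assoc)+)
    also have "\<dots> = (\<Sum>(i, l)\<in>exp_splits n. \<Sum>(j, k)\<in>exp_splits l.
            mps_coeff a i * (mps_coeff b j * mps_coeff c k))"
      by (subst sum.Sigma[symmetric]) (auto simp: case_prod_unfold)
    also have "\<dots> = mps_coeff (a * (b * c)) n"
      by (simp add: times_mps_def sum_distrib_left case_prod_unfold)
    finally show "mps_coeff (a * b * c) n = mps_coeff (a * (b * c)) n" .
  qed
  show "a * b = b * a"
    unfolding times_mps_def
    by (rule arg_cong[of _ _ Abs_mps], rule ext,
        rule sum.reindex_bij_witness[where i = prod.swap and j = prod.swap])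
       (auto simp: exp_splits_def add.commute mult.commute)
  show "1 * a = a"
  proof (rule mps_eqI)
    fix n :: "'a \<Rightarrow> nat"
    let ?z = "\<lambda>_::'a. 0::nat"
    have eq: "mps_coeff 1 i * mps_coeff a j = (if (i, j) = (?z, n) then mps_coeff a n else 0)"
      if "(i, j) \<in> exp_splits n" for i j
    proof (cases "i = ?z")
      case True
      with that have "j = n" by (auto simp: exp_splits_def)
      with True show ?thesis by (simp add: one_mps_def)
    qed (simp add: one_mps_def)
    have mem: "(?z, n) \<in> exp_splits n" by (simp add: exp_splits_def)
    have "mps_coeff (1 * a) n
        = (\<Sum>x\<in>exp_splits n. if x = (?z, n) then mps_coeff a n else 0)"
      unfolding times_mps_def mps_coeff_Abs by (rule sum.cong) (auto simp: eq split: if_splits)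
    also have "\<dots> = mps_coeff a n"
      using mem by (simp add: sum.delta)
    finally show "mps_coeff (1 * a) n = mps_coeff a n" .
  qed
  show "(a + b) * c = a * c + b * c"
    by (rule mps_eqI)
       (simp add: times_mps_def plus_mps_def distrib_right sum.distrib case_prod_unfold)
  show "(0 :: ('a, 'b) mps) \<noteq> 1"
  proof
    assume "(0 :: ('a, 'b) mps) = 1"
    then have "mps_coeff (0 :: ('a, 'b) mps) (\<lambda>_. 0) = mps_coeff 1 (\<lambda>_. 0)" by simp
    then show False by (simp add: zero_mps_def one_mps_def)
  qed
qed (auto intro!: mps_eqI simp: zero_mps_def plus_mps_def minus_mps_def uminus_mps_def)

end

definition mps_const :: "'a \<Rightarrow> ('d, 'a::zero) mps" where
  "mps_const c = Abs_mps (\<lambda>n. if n = (\<lambda>_. 0) then c else 0)"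

definition mps_map :: "('a \<Rightarrow> 'b) \<Rightarrow> ('d, 'a) mps \<Rightarrow> ('d, 'b) mps" where
  "mps_map h f = Abs_mps (\<lambda>n. h (mps_coeff f n))"

text \<open>
  \<open>\<tau>(\<gamma>)\<close> is the product over i of the binomial series of \<open>1 + T_i\<close> with p-adic exponent
  \<open>\<gamma>_i\<close>.  Its coefficients lie in the p-adic integers; they are viewed in K.
\<close>

definition tau :: "('p::prime_card padic \<Rightarrow> 'k::field_char_0) \<Rightarrow> ('d::finite \<Rightarrow> 'p padic_int) \<Rightarrow> ('d, 'k) mps" where
  "tau \<iota> \<gamma> = Abs_mps (\<lambda>n. \<Prod>i\<in>UNIV. fps_nth (fps_binomial (\<iota> (to_fract (\<gamma> i)))) (n i))"


section \<open>Iwasawa invariants\<close>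

definition integral_mps :: "('k::field \<Rightarrow> real) \<Rightarrow> ('d, 'k) mps \<Rightarrow> bool" where
  "integral_mps v F \<longleftrightarrow> (\<forall>n. mps_coeff F n \<in> valuation_ring v)"

definition primitive_factorization ::
  "('k::field \<Rightarrow> real) \<Rightarrow> 'k \<Rightarrow> ('d::finite, 'k) mps \<Rightarrow> int \<Rightarrow> ('d, 'k) mps \<Rightarrow> bool" where
  "primitive_factorization v \<pi> F N F0 \<longleftrightarrow>
     F = mps_const (\<pi> powi N) * F0 \<and> integral_mps v F0
     \<and> \<not> (\<exists>H. integral_mps v H \<and> F0 = mps_const \<pi> * H)"

definition mu_invariant :: "nat \<Rightarrow> ('k::field \<Rightarrow> real) \<Rightarrow> 'k \<Rightarrow> ('d::finite, 'k) mps \<Rightarrow> real" where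
  "mu_invariant p v \<pi> F =
     of_int (THE N. \<exists>F0. primitive_factorization v \<pi> F N F0) / real (ramification_index p v \<pi>)"

definition primitive_part :: "('k::field \<Rightarrow> real) \<Rightarrow> 'k \<Rightarrow> ('d::finite, 'k) mps \<Rightarrow> ('d, 'k) mps" where
  "primitive_part v \<pi> F = (THE F0. \<exists>N. primitive_factorization v \<pi> F N F0)"

text \<open>Meant for integral domains, where height one means: nonzero prime, with no prime
  strictly between it and the zero ideal.\<close>

definition height_one_prime :: "'a::comm_ring_1 set \<Rightarrow> bool" where
  "height_one_prime I \<longleftrightarrow>
     primeideal I ring_of_type_algebra \<and> I \<noteq> {0}
     \<and> (\<forall>J. primeideal J ring_of_type_algebra \<and> J \<subset> I \<longrightarrow> J = {0})"

text \<open>For a principal prime ideal, the order of f is the largest power of a generator dividing f.\<close>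

definition ord_at :: "'a::comm_ring_1 set \<Rightarrow> 'a \<Rightarrow> nat" where
  "ord_at I f = Max {n. \<exists>g. I = PIdl\<^bsub>ring_of_type_algebra\<^esub> g \<and> g ^ n dvd f}"

definition lambda_invariant ::
  "('p::prime_card padic \<Rightarrow> 'k::field_char_0) \<Rightarrow> ('k \<Rightarrow> real) \<Rightarrow> 'k \<Rightarrow> ('k \<Rightarrow> 'r::field)
     \<Rightarrow> ('d::finite, 'k) mps \<Rightarrow> nat" where
  "lambda_invariant \<iota> v \<pi> red F =
     (let F0 = mps_map red (primitive_part v \<pi> F) in
      \<Sum>I\<in>{I. height_one_prime I \<and> F0 \<in> I
               \<and> (\<exists>\<sigma> :: 'd \<Rightarrow> 'p padic_int.
                    \<not> (\<exists>\<gamma>. \<forall>i. \<sigma> i = of_nat CARD('p) * \<gamma> i)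
                    \<and> I = PIdl\<^bsub>ring_of_type_algebra\<^esub> (mps_map red (tau \<iota> \<sigma> - 1)))}.
        ord_at I F0)"


section \<open>Weighted voltage digraphs and their spectral polynomials\<close>

definition finite_symmetric_digraph :: "('v, 'e) pre_digraph \<Rightarrow> ('e \<Rightarrow> 'e) \<Rightarrow> bool" where
  "finite_symmetric_digraph \<X> arev \<longleftrightarrow> fin_digraph \<X> \<and> bidirected_digraph \<X> arev"

definition grover_weight :: "('v, 'e) pre_digraph \<Rightarrow> 'e \<Rightarrow> 'k::field" where
  "grover_weight \<X> e = 2 / of_nat (out_degree \<X> (tail \<X> e))"

definition voltage_assignment ::
  "('v, 'e) pre_digraph \<Rightarrow> ('e \<Rightarrow> 'e) \<Rightarrow> ('e \<Rightarrow> 'd \<Rightarrow> 'p::prime_card padic_int) \<Rightarrow> bool" where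
  "voltage_assignment \<X> arev \<alpha> \<longleftrightarrow> (\<forall>e\<in>arcs \<X>. \<forall>i. \<alpha> (arev e) i = - \<alpha> e i)"

definition group_voltage ::
  "('v, 'e) pre_digraph \<Rightarrow> ('e \<Rightarrow> 'e) \<Rightarrow> ('g, 'm) monoid_scheme \<Rightarrow> ('e \<Rightarrow> 'g) \<Rightarrow> bool" where
  "group_voltage \<X> arev G \<beta> \<longleftrightarrow>
     (\<forall>e\<in>arcs \<X>. \<beta> e \<in> carrier G \<and> \<beta> (arev e) = inv\<^bsub>G\<^esub> (\<beta> e))"

text \<open>The Galois cover \<open>\<X>(G, \<beta>)\<close> of \<X>; the covering map on arcs is \<^const>\<open>fst\<close>.\<close>

definition derived_digraph ::
  "('v, 'e) pre_digraph \<Rightarrow> ('g, 'm) monoid_scheme \<Rightarrow> ('e \<Rightarrow> 'g) \<Rightarrow> ('v \<times> 'g, 'e \<times> 'g) pre_digraph" where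
  "derived_digraph \<X> G \<beta> =
     \<lparr> verts = verts \<X> \<times> carrier G,
       arcs = arcs \<X> \<times> carrier G,
       tail = (\<lambda>(e, g). (tail \<X> e, g)),
       head = (\<lambda>(e, g). (head \<X> e, g \<otimes>\<^bsub>G\<^esub> \<beta> e)) \<rparr>"

definition derived_arev ::
  "('v, 'e) pre_digraph \<Rightarrow> ('e \<Rightarrow> 'e) \<Rightarrow> ('g, 'm) monoid_scheme \<Rightarrow> ('e \<Rightarrow> 'g) \<Rightarrow> 'e \<times> 'g \<Rightarrow> 'e \<times> 'g" where
  "derived_arev \<X> arev G \<beta> =
     (\<lambda>(e, g). if e \<in> arcs \<X> \<and> g \<in> carrier G then (arev e, g \<otimes>\<^bsub>G\<^esub> \<beta> e) else (e, g))"

lemma finite_symmetric_digraph_derived: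
  assumes \<X>: "finite_symmetric_digraph \<X> arev" and G: "group G" "finite (carrier G)"
    and \<beta>: "group_voltage \<X> arev G \<beta>"
  shows "finite_symmetric_digraph (derived_digraph \<X> G \<beta>) (derived_arev \<X> arev G \<beta>)"
proof -
  interpret \<X>: fin_digraph \<X> using \<X> by (simp add: finite_symmetric_digraph_def)
  interpret \<X>: bidirected_digraph \<X> arev using \<X> by (simp add: finite_symmetric_digraph_def)
  interpret G: group G by fact
  have b: "\<beta> e \<in> carrier G" "\<beta> (arev e) = inv\<^bsub>G\<^esub> (\<beta> e)" if "e \<in> arcs \<X>" for e
    using \<beta> that by (auto simp: group_voltage_def)
  have "fin_digraph (derived_digraph \<X> G \<beta>)"
    by unfold_locales (auto simp: derived_digraph_def b G)
  moreover have "bidirected_digraph (derived_digraph \<X> G \<beta>) (derived_arev \<X> arev G \<beta>)"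
    by unfold_locales
       (auto simp: derived_digraph_def derived_arev_def b G.m_assoc \<X>.arev_neq split: if_splits)
  ultimately show ?thesis by (simp add: finite_symmetric_digraph_def)
qed

text \<open>Determinant of a matrix indexed by a finite set.\<close>

definition det_on :: "'v set \<Rightarrow> ('v \<Rightarrow> 'v \<Rightarrow> 'a::comm_ring_1) \<Rightarrow> 'a" where
  "det_on V M = (\<Sum>\<sigma> | \<sigma> permutes V. of_int (sign \<sigma>) * (\<Prod>v\<in>V. M v (\<sigma> v)))"

lemma det_on_eq_det:
  "A \<in> carrier_mat n n \<Longrightarrow> det_on {0..<n} (\<lambda>i j. A $$ (i, j)) = Determinant.det A"
  by (auto simp: det_on_def Determinant.det_def)

definition weight_matrix ::
  "('p::prime_card padic \<Rightarrow> 'k::field_char_0) \<Rightarrow> ('v, 'e) pre_digraph \<Rightarrow> ('e \<Rightarrow> 'k)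
     \<Rightarrow> ('e \<Rightarrow> 'd::finite \<Rightarrow> 'p padic_int) \<Rightarrow> 'v \<Rightarrow> 'v \<Rightarrow> ('d, 'k) mps" where
  "weight_matrix \<iota> Z w \<alpha> x y =
     (\<Sum>e | e \<in> arcs Z \<and> tail Z e = x \<and> head Z e = y. mps_const (w e) * tau \<iota> (\<alpha> e))"

text \<open>The polynomial variable is A.\<close>

definition spectral_poly ::
  "('p::prime_card padic \<Rightarrow> 'k::field_char_0) \<Rightarrow> ('v, 'e) pre_digraph \<Rightarrow> ('e \<Rightarrow> 'k)
     \<Rightarrow> ('e \<Rightarrow> 'd::finite \<Rightarrow> 'p padic_int) \<Rightarrow> ('d, 'k) mps poly" where
  "spectral_poly \<iota> Z w \<alpha> =
     det_on (verts Z) (\<lambda>x y.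
       (if x = y then monom 1 2 else 0)
       - monom (weight_matrix \<iota> Z w \<alpha> x y) 1
       + (if x = y then [: mps_const (\<Sum>e\<in>out_arcs Z x. w e) :] else 0)
       - (if x = y then 1 else 0))"

definition resultant_series ::
  "('p::prime_card padic \<Rightarrow> 'k::field_char_0) \<Rightarrow> ('v, 'e) pre_digraph \<Rightarrow> ('e \<Rightarrow> 'k)
     \<Rightarrow> ('e \<Rightarrow> 'd::finite \<Rightarrow> 'p padic_int) \<Rightarrow> 'k poly \<Rightarrow> ('d, 'k) mps" where
  "resultant_series \<iota> Z w \<alpha> P = resultant (spectral_poly \<iota> Z w \<alpha>) (map_poly mps_const P)"

end

theory Submission
  imports Defs "HOL-Algebra.Group_Action"
begin

text \<open>
  Everything is reduced modulo the maximal ideal.  Over the residue field, the matrix of the cover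
  is a group matrix of G with entries in a commutative ring of characteristic p.  Expand its
  determinant by the Leibniz formula and let G act on the permutations by conjugation with left
  translations: orbits of size divisible by p cancel, and the equivariant permutations together
  with the Frobenius give the determinant for the base to the power \<open>|G|\<close>.  Resultants are
  multiplicative, so the reduction of \<open>R_Y\<close> is the \<open>|G|\<close>-th power of the reduction of
  \<open>R_X\<close>.  For an integral series, \<open>\<mu> = 0\<close> says that the reduction is nonzero, and then
  \<open>\<lambda>\<close> is read off the reduction and is additive on products.
\<close>

section \<open>Power series over an integral domain\<close>

text \<open>The size of a Sylvester matrix is the sum of the two degrees, so reduction commutes with
  the resultant only if no degree drops; the spectral polynomials and \<open>P\<close> are monic,
  which secures this. Multiplicativity is wanted over power series over the residue field, where no
  roots are at hand, so it comes from an identity between Sylvester-type matrices. The exponent |G|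
  arises as follows. A permutation commuting with all left translations is a pair (s, b) of a
  permutation s of V and a twist b from V to G. Its matrix entry at (x, g) does not depend on g, so
  every x contributes |G| equal factors. Summation over all b factors over V, and since |G| is a
  power of p the Frobenius moves the exponent outside the whole sum. The delicate point is the sign:
  a twist may be odd when |G| is even, but then the characteristic is 2 and signs are invisible.
  Integrality of the two resultants also rests on the p-adic integrality of binomial coefficients
  with p-adic upper argument.\<close>

lemma mps_coeff_0 [simp]: "mps_coeff 0 n = 0"
  and mps_coeff_1: "mps_coeff 1 n = (if n = (\<lambda>_. 0) then 1 else 0)"
  and mps_coeff_add [simp]: "mps_coeff (f + g) n = mps_coeff f n + mps_coeff g n"
  and mps_coeff_diff [simp]: "mps_coeff (f - g) n = mps_coeff f n - mps_coeff g n"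
  and mps_coeff_uminus [simp]: "mps_coeff (- f) n = - mps_coeff f n"
  and mps_coeff_mult: "mps_coeff (f * g) n = (\<Sum>(i, j)\<in>exp_splits n. mps_coeff f i * mps_coeff g j)"
  for f g :: "('d::finite, 'a::comm_ring_1) mps"
  by (simp_all add: zero_mps_def one_mps_def plus_mps_def minus_mps_def uminus_mps_def times_mps_def)

lemma mps_coeff_const: "mps_coeff (mps_const c) n = (if n = (\<lambda>_. 0) then c else 0)"
  by (simp add: mps_const_def)

lemma mps_coeff_map [simp]: "mps_coeff (mps_map h f) n = h (mps_coeff f n)"
  by (simp add: mps_map_def)

lemma mps_coeff_const_mult:
  fixes F :: "('d::finite, 'a::comm_ring_1) mps"
  shows "mps_coeff (mps_const c * F) n = c * mps_coeff F n"
proof -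
  have "mps_coeff (mps_const c * F) n
      = (\<Sum>x\<in>exp_splits n. if x = (\<lambda>_. 0, n) then c * mps_coeff F n else 0)"
    unfolding mps_coeff_mult
  proof (intro sum.cong refl, clarify)
    fix i j assume ij: "(i, j) \<in> exp_splits n"
    show "mps_coeff (mps_const c) i * mps_coeff F j
        = (if (i, j) = (\<lambda>_. 0, n) then c * mps_coeff F n else 0)"
    proof (cases "i = (\<lambda>_. 0)")
      case True
      with ij have "j = n" by (simp add: exp_splits_def fun_eq_iff)
      with True show ?thesis by (simp add: mps_coeff_const)
    qed (simp add: mps_coeff_const)
  qed
  also have "\<dots> = c * mps_coeff F n"
    by (subst sum.delta[OF finite_exp_splits]) (simp add: exp_splits_def)
  finally show ?thesis .
qed

lemma of_nat_mps: "(of_nat n :: ('d::finite, 'a::comm_ring_1) mps) = mps_const (of_nat n)"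
  by (induction n) (auto intro!: mps_eqI simp: mps_coeff_1 mps_coeff_const)

text \<open>A monomial order: exponent vectors are compared through their Goedel numbers.\<close>

lemma ex_goedel_numbering:
  "\<exists>\<phi> :: ('d::finite \<Rightarrow> nat) \<Rightarrow> nat. inj \<phi> \<and> (\<forall>i j. \<phi> (\<lambda>x. i x + j x) = \<phi> i * \<phi> j) \<and> (\<forall>i. \<phi> i > 0)"
proof -
  have "\<exists>pr :: 'd \<Rightarrow> nat. inj pr \<and> (\<forall>x. prime (pr x))"
  proof -
    obtain B :: "nat set" where B: "finite B" "card B = CARD('d)" "B \<subseteq> {p. prime p}"
      using infinite_arbitrarily_large[OF primes_infinite, of "CARD('d)"] by blast
    then obtain h where h: "bij_betw h (UNIV :: 'd set) B"
      using finite_same_card_bij[of "UNIV :: 'd set" B] by auto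
    then have "inj h" "\<forall>x. prime (h x)"
      using B(3) by (auto simp: bij_betw_def)
    then show ?thesis by blast
  qed
  then obtain pr :: "'d \<Rightarrow> nat" where pr: "inj pr" "\<And>x. prime (pr x)" by blast
  define \<phi> :: "('d \<Rightarrow> nat) \<Rightarrow> nat" where "\<phi> i = (\<Prod>x\<in>UNIV. pr x ^ i x)" for i
  have nz: "pr x \<noteq> 0" for x using pr(2) by (metis not_prime_0)
  have mult: "multiplicity (pr y) (\<phi> i) = i y" for i y
  proof -
    have "multiplicity (pr y) (\<phi> i) = (\<Sum>x\<in>UNIV. multiplicity (pr y) (pr x ^ i x))"
      unfolding \<phi>_def by (subst prime_elem_multiplicity_prod_distrib) (auto simp: nz pr(2))
    also have "\<dots> = (\<Sum>x\<in>UNIV. if x = y then i y else 0)"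
    proof (intro sum.cong refl)
      fix x
      show "multiplicity (pr y) (pr x ^ i x) = (if x = y then i y else 0)"
      proof (cases "x = y")
        case True
        then show ?thesis using pr(2)[of y] nz[of y]
          by (simp add: multiplicity_same_power not_prime_unit)
      next
        case False
        then have "pr y \<noteq> pr x" using pr(1) by (simp add: inj_eq)
        with False show ?thesis using pr(2) by (simp add: multiplicity_distinct_prime_power)
      qed
    qed
    finally show ?thesis by simp
  qed
  have "inj \<phi>" by (rule injI, rule ext) (metis mult)
  moreover have "\<phi> (\<lambda>x. i x + j x) = \<phi> i * \<phi> j" for i j
    by (simp add: \<phi>_def power_add prod.distrib)
  moreover have "\<phi> i > 0" for i
    using pr(2) by (auto simp: \<phi>_def intro!: prod_pos prime_gt_0_nat)
  ultimately show ?thesis by blast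
qed

text \<open>The lowest terms cannot cancel. If \<open>a\<close> and \<open>b\<close> have least
  Goedel number in the two supports, then \<phi> i * \<phi> j = \<phi> a * \<phi> b with both left
  factors at least as large forces i = a and j = b, so the coefficient at a + b is a single nonzero
  product.\<close>

instance mps :: (finite, idom) idom
proof
  fix f g :: "('a, 'b) mps"
  assume "f \<noteq> 0" "g \<noteq> 0"
  obtain \<phi> :: "('a \<Rightarrow> nat) \<Rightarrow> nat" where inj: "inj \<phi>"
    and add: "\<And>i j. \<phi> (\<lambda>x. i x + j x) = \<phi> i * \<phi> j" and pos: "\<And>i. \<phi> i > 0"
    using ex_goedel_numbering by metis
  have "\<exists>a. mps_coeff h a \<noteq> 0 \<and> (\<forall>b. mps_coeff h b \<noteq> 0 \<longrightarrow> \<phi> a \<le> \<phi> b)" if "h \<noteq> 0" for h :: "('a, 'b) mps"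
  proof -
    have "\<exists>a. mps_coeff h a \<noteq> 0" using that by (metis mps_eqI mps_coeff_0)
    then show ?thesis using ex_has_least_nat[of "\<lambda>a. mps_coeff h a \<noteq> 0" _ \<phi>] by blast
  qed
  from this[OF \<open>f \<noteq> 0\<close>] this[OF \<open>g \<noteq> 0\<close>] obtain a b
    where a: "mps_coeff f a \<noteq> 0" "\<And>i. mps_coeff f i \<noteq> 0 \<Longrightarrow> \<phi> a \<le> \<phi> i"
      and b: "mps_coeff g b \<noteq> 0" "\<And>i. mps_coeff g i \<noteq> 0 \<Longrightarrow> \<phi> b \<le> \<phi> i" by blast
  define c where "c = (\<lambda>x. a x + b x)"
  have "mps_coeff (f * g) c
      = (\<Sum>x\<in>exp_splits c. if x = (a, b) then mps_coeff f a * mps_coeff g b else 0)"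
    unfolding mps_coeff_mult
  proof (intro sum.cong refl, clarify)
    fix i j assume ij: "(i, j) \<in> exp_splits c"
    have "i = a \<and> j = b" if nz: "mps_coeff f i \<noteq> 0" "mps_coeff g j \<noteq> 0"
    proof -
      have "c = (\<lambda>x. i x + j x)" using ij by (simp add: exp_splits_def fun_eq_iff)
      then have "\<phi> c = \<phi> i * \<phi> j" by (simp add: add)
      moreover have "\<phi> c = \<phi> a * \<phi> b" by (simp add: c_def add)
      ultimately have eq: "\<phi> i * \<phi> j = \<phi> a * \<phi> b" by simp
      have le: "\<phi> a \<le> \<phi> i" "\<phi> b \<le> \<phi> j" using a(2) b(2) nz by auto
      have "\<phi> i = \<phi> a"
      proof (rule ccontr)
        assume "\<phi> i \<noteq> \<phi> a"
        then have "\<phi> a * \<phi> b < \<phi> i * \<phi> b" using le pos[of b] by simp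
        also have "\<dots> \<le> \<phi> i * \<phi> j" using le by simp
        finally show False using eq by simp
      qed
      moreover from this have "\<phi> j = \<phi> b" using eq pos[of a] by simp
      ultimately show ?thesis using inj by (simp add: inj_eq)
    qed
    then show "mps_coeff f i * mps_coeff g j
        = (if (i, j) = (a, b) then mps_coeff f a * mps_coeff g b else 0)" by auto
  qed
  also have "\<dots> = mps_coeff f a * mps_coeff g b"
    by (subst sum.delta[OF finite_exp_splits]) (simp add: exp_splits_def c_def)
  finally show "f * g \<noteq> 0" using a(1) b(1) by auto
qed

text \<open>Each factor \<open>g\<close> lacks a constant term and hence raises the total degree by
  at least one. This bounds the powers of \<open>g\<close> that divide a nonzero series, which keeps
  orders finite.\<close>

lemma mps_coeff_power_mult_eq_0:
  fixes g h :: "('d::finite, 'a::comm_ring_1) mps"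
  assumes "mps_coeff g (\<lambda>_. 0) = 0" and "(\<Sum>x\<in>UNIV. m x) < n"
  shows "mps_coeff (g ^ n * h) m = 0"
  using assms(2)
proof (induction n arbitrary: m)
  case (Suc n)
  have "mps_coeff g i * mps_coeff (g ^ n * h) j = 0" if "(i, j) \<in> exp_splits m" for i j
  proof (cases "i = (\<lambda>_. 0)")
    case False
    then obtain x where "i x \<noteq> 0" by auto
    have m: "m = (\<lambda>x. i x + j x)" using that by (simp add: exp_splits_def fun_eq_iff)
    have "0 < (\<Sum>x\<in>UNIV. i x)" using \<open>i x \<noteq> 0\<close> by (simp add: sum_pos2[of UNIV x])
    then have "(\<Sum>x\<in>UNIV. j x) < n"
      using Suc.prems by (simp add: m sum.distrib)
    then show ?thesis using Suc.IH by simp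
  qed (simp add: assms(1))
  then show ?case
    by (auto simp: mult.assoc mps_coeff_mult[of g] intro!: sum.neutral)
qed simp

section \<open>Multiplicativity of the resultant\<close>

lemma coeff_sum_monom:
  assumes "degree p < N"
  shows "(\<Sum>k<N. monom (coeff p (N - 1 - k)) (N - 1 - k)) = p"
proof -
  have "(\<Sum>k<N. monom (coeff p (N - 1 - k)) (N - 1 - k)) = (\<Sum>k<N. monom (coeff p k) k)"
    using sum.nat_diff_reindex[of "\<lambda>k. monom (coeff p k) k" N] by simp
  also have "\<dots> = p"
  proof (rule poly_eqI)
    fix i
    show "coeff (\<Sum>k<N. monom (coeff p k) k) i = coeff p i"
      using assms by (auto simp: coeff_sum coeff_eq_0)
  qed
  finally show ?thesis .
qed

text \<open>Columns of a Sylvester matrix run from the highest power down to the constant term,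
  hence the reversed exponent. Reading rows as polynomials turns matrix identities into polynomial
  identities.\<close>

definition row_poly :: "'a::comm_ring_1 mat \<Rightarrow> nat \<Rightarrow> 'a poly" where
  "row_poly M i = (\<Sum>j<dim_col M. monom (M $$ (i, j)) (dim_col M - 1 - j))"

lemma coeff_row_poly:
  assumes "j < dim_col M"
  shows "coeff (row_poly M i) (dim_col M - 1 - j) = M $$ (i, j)"
proof -
  have "coeff (row_poly M i) (dim_col M - 1 - j) = (\<Sum>k<dim_col M. if k = j then M $$ (i, j) else 0)"
    unfolding row_poly_def coeff_sum using assms by (intro sum.cong refl) auto
  then show ?thesis using assms by simp
qed

lemma mat_eq_row_polyI:
  assumes "A \<in> carrier_mat n m" "B \<in> carrier_mat n m" "\<And>i. i < n \<Longrightarrow> row_poly A i = row_poly B i"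
  shows "A = B"
proof (rule eq_matI)
  fix i j assume "i < dim_row B" "j < dim_col B"
  then show "A $$ (i, j) = B $$ (i, j)"
    using assms coeff_row_poly[of j A i] coeff_row_poly[of j B i] by simp
qed (use assms in auto)

lemma row_poly_mult:
  assumes "A \<in> carrier_mat n m" "B \<in> carrier_mat m l" "i < n"
  shows "row_poly (A * B) i = (\<Sum>k<m. smult (A $$ (i, k)) (row_poly B k))"
proof -
  have "row_poly (A * B) i = (\<Sum>j<l. \<Sum>k<m. smult (A $$ (i, k)) (monom (B $$ (k, j)) (l - 1 - j)))"
    using assms
    by (auto simp: row_poly_def scalar_prod_def monom_sum atLeast0LessThan smult_monom intro!: sum.cong)
  also have "\<dots> = (\<Sum>k<m. smult (A $$ (i, k)) (row_poly B k))"
    using assms by (subst sum.swap) (simp add: row_poly_def smult_sum2)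
  finally show ?thesis .
qed

lemma row_poly_eqI:
  assumes "degree p < dim_col M" "\<And>j. j < dim_col M \<Longrightarrow> M $$ (i, j) = coeff p (dim_col M - 1 - j)"
  shows "row_poly M i = p"
proof -
  have "row_poly M i = (\<Sum>k<dim_col M. monom (coeff p (dim_col M - 1 - k)) (dim_col M - 1 - k))"
    unfolding row_poly_def using assms(2) by (intro sum.cong refl) auto
  then show ?thesis using coeff_sum_monom[OF assms(1)] by simp
qed

lemma degree_monom_mult_less:
  fixes p :: "'a::comm_ring_1 poly"
  assumes "degree p \<le> d" "k + d < N"
  shows "degree (monom 1 k * p) < N"
  using assms degree_mult_le[of "monom 1 k" p] degree_monom_le[of "1::'a" k] by linarith

text \<open>The rows are shifts of \<open>p\<close> and of \<open>q\<close> by decreasing powers.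
  The formal degrees \<open>m\<close> and \<open>n\<close> may exceed the true ones; this slack is
  used when \<open>g\<close> is paired with factors of different degrees.\<close>

lemma row_poly_sylvester:
  fixes p q :: "'a::comm_ring_1 poly"
  assumes "degree p \<le> m" "degree q \<le> n" "i < m + n"
  shows "row_poly (sylvester_mat_sub m n p q) i
    = (if i < n then monom 1 (n - 1 - i) * p else monom 1 (m + n - 1 - i) * q)"
proof (rule row_poly_eqI)
  show "degree (if i < n then monom 1 (n - 1 - i) * p else monom 1 (m + n - 1 - i) * q)
      < dim_col (sylvester_mat_sub m n p q)"
    using assms degree_monom_mult_less[OF assms(1), of "n - 1 - i" "m + n"]
      degree_monom_mult_less[OF assms(2), of "m + n - 1 - i" "m + n"] by auto
next
  fix j assume "j < dim_col (sylvester_mat_sub m n p q)"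
  then show "sylvester_mat_sub m n p q $$ (i, j) = coeff (if i < n then monom 1 (n - 1 - i) * p
      else monom 1 (m + n - 1 - i) * q) (dim_col (sylvester_mat_sub m n p q) - 1 - j)"
    using assms
    by (auto simp: sylvester_mat_sub_index coeff_monom_mult intro!: coeff_eq_0 arg_cong[of _ _ "coeff p"]
        arg_cong[of _ _ "coeff q"])
qed

text \<open>The larger Sylvester matrix is block triangular with a unitriangular block.\<close>

lemma resultant_sub_monic:
  fixes f g :: "'a::idom poly"
  assumes f: "degree f = m" "lead_coeff f = 1" and g: "degree g \<le> n"
  shows "resultant_sub m (n + l) f g = resultant_sub m n f g"
proof -
  let ?S = "sylvester_mat_sub m (n + l) f g"
  define A where "A = mat l l (\<lambda>(i, j). ?S $$ (i, j))"
  define B where "B = mat l (m + n) (\<lambda>(i, j). ?S $$ (i, l + j))"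
  have S: "?S = four_block_mat A B (0\<^sub>m (m + n) l) (sylvester_mat_sub m n f g)"
    (is "_ = ?R")
  proof (rule eq_matI)
    fix i j assume "i < dim_row ?R" "j < dim_col ?R"
    then have ij: "i < m + n + l" "j < m + n + l" by (auto simp: A_def)
    \<comment> \<open>In the enlarged matrix each row of \<open>g\<close> begins with coefficients
      of formal degree above \<open>n\<close>; their vanishing yields the zero block in the lower
      left.\<close>
    have z: "coeff g k = 0" if "k > n" for k using that g by (simp add: coeff_eq_0)
    show "?S $$ (i, j) = ?R $$ (i, j)"
    proof (cases "i < l")
      case True
      then show ?thesis using ij by (cases "j < l") (simp_all add: A_def B_def)
    next
      case False
      then obtain i' where i: "i = l + i'" by (metis le_Suc_ex not_less)
      show ?thesis
      proof (cases "j < l")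
        case True
        then show ?thesis using ij i by (simp add: A_def sylvester_mat_sub_index z)
      next
        case False
        then obtain j' where j: "j = l + j'" by (metis le_Suc_ex not_less)
        have "?R $$ (i, j) = sylvester_mat_sub m n f g $$ (i', j')"
          using ij by (simp add: i j A_def)
        also have "\<dots> = ?S $$ (i, j)"
        proof (cases "i' < n")
          case True
          then show ?thesis using ij by (simp add: i j sylvester_mat_sub_index)
        next
          case False
          then show ?thesis using ij by (simp add: i j sylvester_mat_sub_index z)
        qed
        finally show ?thesis by simp
      qed
    qed
  qed (auto simp: A_def)
  have "det A = prod_list (diag_mat A)"
    by (rule det_upper_triangular[of _ l])
       (auto simp: A_def sylvester_mat_sub_index intro!: upper_triangularI)
  also have "\<dots> = 1"
    using f by (intro prod_list_neutral)
       (auto simp: A_def diag_mat_def sylvester_mat_sub_index)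
  finally have "det A = 1" .
  then show ?thesis
    unfolding resultant_sub_def S
    by (subst det_four_block_mat_lower_left_zero[where n = l and m = "m + n"])
       (auto simp: A_def B_def)
qed

text \<open>With \<open>S(f, g)\<close> the matrix of \<open>(u, v) \<mapsto> u * f + v * g\<close>, this compares two ways to write the map
  \<open>(u, v\<^sub>2, v\<^sub>1) \<mapsto> u * f\<^sub>1 * f\<^sub>2 + (f\<^sub>1 * v\<^sub>2 + v\<^sub>1) * g = f\<^sub>1 * (u * f\<^sub>2 + v\<^sub>2 * g) + v\<^sub>1 * g\<close>.\<close>

lemma resultant_mult_monic_left:
  fixes f1 f2 g :: "'a::idom poly"
  assumes f1: "lead_coeff f1 = 1" and f2: "lead_coeff f2 = 1"
  shows "resultant (f1 * f2) g = resultant f1 g * resultant f2 g"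
proof -
  define m1 m2 n where "m1 = degree f1" and "m2 = degree f2" and "n = degree g"
  define N where "N = m1 + m2 + n"
  have nz: "f1 \<noteq> 0" "f2 \<noteq> 0" using f1 f2 by auto
  then have deg: "degree (f1 * f2) = m1 + m2" by (simp add: degree_mult_eq m1_def m2_def)
  \<comment> \<open>\<open>D\<close> encodes (u, v2, v1) \<mapsto> (u, f1 * v2 + v1): identity rows
    outside, shifts of \<open>f1\<close> in the middle. Its diagonal entries there are the leading
    coefficient of \<open>f1\<close>, so it is unitriangular.\<close>
  define D where "D = mat N N (\<lambda>(i, k). if i < n \<or> n + m2 \<le> i then if i = k then 1 else 0
      else if n \<le> k then coeff (monom 1 (n + m2 - 1 - i) * f1) (N - 1 - k) else 0)"
  define S where "S = sylvester_mat_sub (m1 + m2) n (f1 * f2) g"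
  define E2 where "E2 = sylvester_mat_sub m2 n f2 g"
  \<comment> \<open>\<open>E\<close> encodes (u, v2, v1) \<mapsto> (u * f2 + v2 * g, v1), and
    \<open>F\<close> below encodes (u', v1) \<mapsto> u' * f1 + v1 * g. Here u' has n + m2
    coefficients, so \<open>g\<close> carries formal degree n + m2 in \<open>F\<close>.\<close>
  define E where "E = four_block_mat E2 (0\<^sub>m (n + m2) m1) (0\<^sub>m m1 (n + m2)) (1\<^sub>m m1)"
  define F where "F = sylvester_mat_sub m1 (n + m2) f1 g"
  have E2c: "E2 \<in> carrier_mat (n + m2) (n + m2)" by (auto simp: E2_def)
  have c: "D \<in> carrier_mat N N" "S \<in> carrier_mat N N" "E \<in> carrier_mat N N" "F \<in> carrier_mat N N"
    by (auto simp: D_def S_def E_def E2_def F_def N_def)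
  have "D * S = E * F"
  proof (rule mat_eq_row_polyI)
    fix i assume i: "i < N"
    have rS: "row_poly S k = (if k < n then monom 1 (n - 1 - k) * (f1 * f2) else monom 1 (N - 1 - k) * g)"
      if "k < N" for k
      using that deg row_poly_sylvester[of "f1 * f2" "m1 + m2" g n k] by (simp add: S_def n_def N_def)
    have rF: "row_poly F k = (if k < n + m2 then monom 1 (n + m2 - 1 - k) * f1 else monom 1 (N - 1 - k) * g)"
      if "k < N" for k
      using that row_poly_sylvester[of f1 m1 g "n + m2" k] by (simp add: F_def n_def m1_def N_def add_ac)
    have DS: "row_poly (D * S) i = (\<Sum>k<N. smult (D $$ (i, k)) (row_poly S k))"
      and EF: "row_poly (E * F) i = (\<Sum>k<N. smult (E $$ (i, k)) (row_poly F k))"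
      using row_poly_mult c i by blast+
    show "row_poly (D * S) i = row_poly (E * F) i"
    proof (cases "i < n + m2")
      case False
      have "row_poly (D * S) i = (\<Sum>k<N. if k = i then row_poly S i else 0)"
        unfolding DS using False i by (intro sum.cong refl) (auto simp: D_def)
      moreover have "row_poly (E * F) i = (\<Sum>k<N. if k = i then row_poly F i else 0)"
        unfolding EF using False i E2c by (intro sum.cong refl) (auto simp: E_def N_def)
      ultimately show ?thesis using False i by (simp add: rS rF)
    next
      case True
      have E2r: "row_poly E2 i = (if i < n then monom 1 (n - 1 - i) * f2 else monom 1 (n + m2 - 1 - i) * g)"
        using True row_poly_sylvester[of f2 m2 g n i] by (simp add: E2_def m2_def n_def add_ac)
      have "row_poly (E * F) i = (\<Sum>k<n + m2. smult (E $$ (i, k)) (row_poly F k))"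
        unfolding EF using True E2c by (intro sum.mono_neutral_right) (auto simp: E_def N_def)
      also have "\<dots> = (\<Sum>k<n + m2. monom (E2 $$ (i, k)) (n + m2 - 1 - k) * f1)"
        using True E2c
        by (intro sum.cong refl) (auto simp: E_def N_def rF smult_monom simp flip: mult_smult_left)
      also have "\<dots> = row_poly E2 i * f1"
        using E2c by (simp add: row_poly_def sum_distrib_right)
      finally have EF': "row_poly (E * F) i = row_poly E2 i * f1" .
      show ?thesis
      proof (cases "i < n")
        case iN: True
        have "row_poly (D * S) i = (\<Sum>k<N. if k = i then row_poly S i else 0)"
          unfolding DS using iN i by (intro sum.cong refl) (auto simp: D_def)
        then show ?thesis using i iN by (simp add: EF' E2r rS ac_simps)
      next
        case iN: False
        define p where "p = monom 1 (n + m2 - 1 - i) * f1"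
        have dp: "degree p < m1 + m2"
          unfolding p_def using iN True by (intro degree_monom_mult_less[of f1 m1]) (auto simp: m1_def)
        have "row_poly (D * S) i = (\<Sum>k\<in>{n..<N}. smult (D $$ (i, k)) (row_poly S k))"
          unfolding DS using True iN i by (intro sum.mono_neutral_right) (auto simp: D_def)
        also have "\<dots> = (\<Sum>k\<in>{n..<N}. monom (coeff p (N - 1 - k)) (N - 1 - k) * g)"
          using True iN i
          by (intro sum.cong refl) (auto simp: D_def rS p_def smult_monom simp flip: mult_smult_left)
        also have "\<dots> = (\<Sum>k<m1 + m2. monom (coeff p (m1 + m2 - 1 - k)) (m1 + m2 - 1 - k)) * g"
          unfolding sum_distrib_right
          by (rule sum.reindex_bij_witness[where i = "\<lambda>k. k + n" and j = "\<lambda>k. k - n"]) (auto simp: N_def)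
        also have "\<dots> = p * g" using coeff_sum_monom[OF dp] by simp
        finally show ?thesis using iN by (simp add: EF' E2r p_def ac_simps)
      qed
    qed
  qed (use c in auto)
  moreover have "det D = 1"
  proof -
    have "det D = prod_list (diag_mat D)"
    proof (rule det_upper_triangular[OF _ c(1)], rule upper_triangularI)
      fix i j assume "j < i" "i < dim_row D"
      then show "D $$ (i, j) = 0"
        by (auto simp: D_def coeff_monom_mult N_def m1_def intro!: coeff_eq_0)
    qed
    also have "\<dots> = 1"
      using f1 by (intro prod_list_neutral)
         (auto simp: D_def diag_mat_def coeff_monom_mult N_def m1_def)
    finally show ?thesis .
  qed
  moreover have "det E = det E2"
    unfolding E_def
    by (subst det_four_block_mat_lower_left_zero[OF E2c]) auto
  ultimately have "det S = det E2 * det F"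
    using det_mult[of D N S] det_mult[of E N F] c by simp
  \<comment> \<open>Monicity of \<open>f1\<close> removes the excess \<open>m2\<close> in the formal
    degree of \<open>g\<close>.\<close>
  moreover have "det F = resultant_sub m1 n f1 g"
    using resultant_sub_monic[of f1 m1 g n m2] f1 by (simp add: F_def resultant_sub_def m1_def n_def)
  ultimately show ?thesis
    by (simp add: resultant_sub deg S_def E2_def resultant_sub_def m1_def m2_def n_def)
qed

lemma resultant_power_monic_left:
  fixes f g :: "'a::idom poly"
  assumes "lead_coeff f = 1"
  shows "resultant (f ^ n) g = resultant f g ^ n"
proof (induction n)
  case (Suc n)
  have "lead_coeff (f ^ n) = 1" using assms by (simp add: lead_coeff_power)
  with assms Suc show ?case by (simp add: resultant_mult_monic_left)
qed simp

section \<open>Determinants of group matrices in characteristic p\<close>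

lemma CHAR_eq_prime:
  assumes "prime p" "of_nat p = (0 :: 'a::comm_ring_1)"
  shows "CHAR('a) = p"
proof -
  have "CHAR('a) dvd p" using assms(2) by (simp add: of_nat_eq_0_iff_char_dvd)
  moreover have "CHAR('a) \<noteq> 1" by simp
  ultimately show ?thesis using assms(1) by (auto simp: prime_nat_iff)
qed

text \<open>Elements of \<open>BijGroup E\<close> are extensional functions, hence the
  \<open>restrict\<close>; bijectivity comes from the action of the inverse element.\<close>

lemma (in group) group_actionI:
  assumes closed: "\<And>g x. g \<in> carrier G \<Longrightarrow> x \<in> E \<Longrightarrow> \<phi> g x \<in> E"
    and one: "\<And>x. x \<in> E \<Longrightarrow> \<phi> \<one> x = x"
    and mult: "\<And>g h x. g \<in> carrier G \<Longrightarrow> h \<in> carrier G \<Longrightarrow> x \<in> E \<Longrightarrow> \<phi> (g \<otimes> h) x = \<phi> g (\<phi> h x)"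
  shows "group_action G E (\<lambda>g. restrict (\<phi> g) E)"
proof -
  have inv: "\<phi> (inv g) (\<phi> g x) = x" "\<phi> g (\<phi> (inv g) x) = x" if "g \<in> carrier G" "x \<in> E" for g x
    using that mult[of "inv g" g x] mult[of g "inv g" x] one by auto
  have bij: "restrict (\<phi> g) E \<in> Bij E" if "g \<in> carrier G" for g
  proof -
    have "bij_betw (\<phi> g) E E"
      by (rule bij_betw_byWitness[where f' = "\<phi> (inv g)"]) (use that inv closed in auto)
    then have "bij_betw (restrict (\<phi> g) E) E E" by (simp cong: bij_betw_cong)
    then show ?thesis by (simp add: Bij_def)
  qed
  have "restrict (\<phi> (g \<otimes> h)) E = compose E (restrict (\<phi> g) E) (restrict (\<phi> h) E)"
    if "g \<in> carrier G" "h \<in> carrier G" for g h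
    using that closed mult by (auto simp: compose_def restrict_def)
  then have "(\<lambda>g. restrict (\<phi> g) E) \<in> hom G (BijGroup E)"
    using bij by (intro homI) (auto simp: BijGroup_def)
  then show ?thesis
    by (intro group_action.intro group_hom.intro group_hom_axioms.intro group_BijGroup is_group)
qed

text \<open>The function is constant on each orbit, and by the orbit-stabilizer theorem an orbit has
  size a power of p. An orbit with more than one point therefore contributes a multiple of p, that
  is, zero; the auxiliary \<open>f'\<close> allows the comparison orbit by orbit.\<close>

lemma (in group_action) sum_eq_sum_fixed_points:
  fixes f :: "'c \<Rightarrow> 'r::comm_ring_1"
  assumes p: "prime p" "of_nat p = (0 :: 'r)" and G: "card (carrier G) = p ^ n" and E: "finite E"
    and f: "\<And>g x. g \<in> carrier G \<Longrightarrow> x \<in> E \<Longrightarrow> f (\<phi> g x) = f x"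
  shows "sum f E = sum f {x \<in> E. \<forall>g\<in>carrier G. \<phi> g x = x}"
proof -
  define f' where "f' x = (if \<forall>g\<in>carrier G. \<phi> g x = x then f x else 0)" for x
  interpret group G using group_hom group_hom.axioms(1) by auto
  have un: "\<Union>(orbits G E \<phi>) = E"
  proof
    show "\<Union>(orbits G E \<phi>) \<subseteq> E"
      using element_image by (auto simp: orbits_def orbit_def)
    show "E \<subseteq> \<Union>(orbits G E \<phi>)"
    proof
      fix x assume "x \<in> E"
      then have "x \<in> orbit G \<phi> x" "orbit G \<phi> x \<in> orbits G E \<phi>"
        by (rule orbit_refl, auto simp: orbits_def)
      then show "x \<in> \<Union>(orbits G E \<phi>)" by blast
    qed
  qed
  have fin: "finite A" if "A \<in> orbits G E \<phi>" for A
    using un E that by (metis Union_upper finite_subset)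
  have disj: "A \<inter> B = {}" if "A \<in> orbits G E \<phi>" "B \<in> orbits G E \<phi>" "A \<noteq> B" for A B
    using disjoint_union[of A B] that by blast
  have "sum f A = sum f' A" if A: "A \<in> orbits G E \<phi>" for A
  proof -
    obtain x where x: "x \<in> E" "A = orbit G \<phi> x" using A by (auto simp: orbits_def)
    have AE: "A \<subseteq> E" using A un by blast
    have const: "f y = f x" if "y \<in> A" for y using that x f by (auto simp: orbit_def)
    show ?thesis
    proof (cases "\<exists>y\<in>A. \<forall>g\<in>carrier G. \<phi> g y = y")
      case True
      then obtain y where y: "y \<in> A" "\<forall>g\<in>carrier G. \<phi> g y = y" by blast
      have "z = y" if "z \<in> A" for z
      proof -
        have "z \<in> orbit G \<phi> y"
          using orbit_trans[of y x z] orbit_sym[of x y] x y(1) that AE by blast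
        then show ?thesis using y(2) by (auto simp: orbit_def)
      qed
      then have "A = {y}" using y(1) by blast
      then show ?thesis using y(2) by (simp add: f'_def)
    next
      case False
      have "card A dvd p ^ n"
        using orbit_stabilizer_theorem[OF x(1)] G x(2) by (metis Coset.order_def dvd_triv_left)
      then obtain k where k: "card A = p ^ k" using p(1) divides_primepow_nat by blast
      have "k \<noteq> 0"
      proof
        assume "k = 0"
        then obtain y where y: "A = {y}" using k by (auto simp: card_1_singleton_iff)
        have "\<phi> g y = y" if "g \<in> carrier G" for g
        proof -
          have "y = x" using orbit_refl[OF x(1)] x(2) y by auto
          then have "\<phi> g y \<in> A" using x(2) that by (auto simp: orbit_def)
          then show ?thesis using y by auto
        qed
        then show False using False y by auto
      qed
      then have "of_nat (card A) = (0 :: 'r)" using p(2) k \<open>k \<noteq> 0\<close> by (simp add: power_0_left)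
      moreover have "sum f A = of_nat (card A) * f x" using const by simp
      moreover have "sum f' A = 0" using False by (intro sum.neutral) (auto simp: f'_def)
      ultimately show ?thesis by simp
    qed
  qed
  then have "sum f E = sum f' E"
    using sum.Union_disjoint[of "orbits G E \<phi>" f] sum.Union_disjoint[of "orbits G E \<phi>" f'] fin disj
    by (simp add: un)
  also have "\<dots> = sum f {x \<in> E. \<forall>g\<in>carrier G. \<phi> g x = x}"
    unfolding f'_def using E by (rule sum.inter_filter[symmetric])
  finally show ?thesis .
qed

text \<open>An element of the wreath product of G with the symmetric group of V, acting on V
  \<times> G. The twist multiplies on the right so as to commute with left translations; outside V
  \<times> G the map is the identity, as \<open>permutes\<close> demands.\<close>

definition wreath_perm :: "'v set \<Rightarrow> ('g, 'm) monoid_scheme \<Rightarrow> ('v \<Rightarrow> 'v) \<Rightarrow> ('v \<Rightarrow> 'g) \<Rightarrow> 'v \<times> 'g \<Rightarrow> 'v \<times> 'g" where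
  "wreath_perm V G s b = (\<lambda>(x, g). if x \<in> V \<and> g \<in> carrier G then (s x, g \<otimes>\<^bsub>G\<^esub> b x) else (x, g))"

lemma (in group) wreath_perm_permutes:
  assumes V: "finite V" and G: "finite (carrier G)" and s: "s permutes V" and b: "b \<in> V \<rightarrow> carrier G"
  shows "wreath_perm V G s b permutes V \<times> carrier G"
proof (rule bij_imp_permutes)
  let ?W = "wreath_perm V G s b"
  have "inj_on ?W (V \<times> carrier G)"
  proof (rule inj_onI, clarify)
    fix x g y h assume A: "x \<in> V" "g \<in> carrier G" "y \<in> V" "h \<in> carrier G" "?W (x, g) = ?W (y, h)"
    then have "s x = s y" "g \<otimes> b x = h \<otimes> b y" by (auto simp: wreath_perm_def)
    moreover from this have "x = y" using permutes_inj[OF s] by (simp add: inj_eq)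
    moreover have "b y \<in> carrier G" using A(3) b by auto
    ultimately show "x = y \<and> g = h" using A(2,4) by simp
  qed
  moreover have "?W ` (V \<times> carrier G) \<subseteq> V \<times> carrier G"
    using b permutes_in_image[OF s] by (auto simp: wreath_perm_def Pi_iff)
  ultimately show "bij_betw ?W (V \<times> carrier G) (V \<times> carrier G)"
    using V G by (simp add: bij_betw_def endo_inj_surj)
qed (auto simp: wreath_perm_def split: if_splits)

text \<open>Induction on \<open>H\<close>: a new element \<open>h\<close> composes with one more
  copy of \<open>s\<close>, living on V \<times> {h}, and so contributes one more factor
  \<open>sign s\<close>.\<close>

lemma sign_on_copies:
  fixes V :: "'v set" and H :: "'g set"
  assumes V: "finite V" and s: "s permutes V" and H: "finite H"
  shows "(\<lambda>(x, g). if x \<in> V \<and> g \<in> H then (s x, g) else (x, g)) permutes V \<times> H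
    \<and> sign (\<lambda>(x, g). if x \<in> V \<and> g \<in> H then (s x, g) else (x, g)) = sign s ^ card H"
  using H
proof (induction H rule: finite_induct)
  case empty
  have "(\<lambda>(x, g :: 'g). if x \<in> V \<and> g \<in> {} then (s x, g) else (x, g)) = id" by (simp add: id_def)
  then show ?case by (simp add: permutes_id id_def)
next
  case (insert h H)
  let ?F = "\<lambda>H (x :: 'v, g :: 'g). if x \<in> V \<and> g \<in> H then (s x, g) else (x, g)"
  let ?M = "map_permutation V (\<lambda>x. (x, h)) s"
  have inj: "inj_on (\<lambda>x. (x, h)) V" by (auto simp: inj_on_def)
  have M: "?M permutes V \<times> {h}" using s
    by (intro map_permutation_permutes) (auto simp: bij_betw_def inj_on_def)
  have eq: "?F (insert h H) = ?M \<circ> ?F H"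
  proof
    fix z :: "'v \<times> 'g"
    obtain x g where z: "z = (x, g)" by (cases z)
    have Mh: "?M (y, h) = (s y, h)" if "y \<in> V" for y
      using map_permutation_apply[OF inj that] by simp
    have M': "?M (y, k) = (y, k)" if "y \<notin> V \<or> k \<noteq> h" for y k
      using permutes_not_in[OF M, of "(y, k)"] that by auto
    show "?F (insert h H) z = (?M \<circ> ?F H) z"
    proof (cases "x \<in> V \<and> g \<in> H")
      case True
      then have "g \<noteq> h" using insert.hyps(2) by auto
      then show ?thesis using True M'[of "s x" g] by (simp add: z)
    next
      case False
      then show ?thesis using Mh[of x] M'[of x g] by (auto simp: z)
    qed
  qed
  have P: "?F H permutes V \<times> insert h H" "?M permutes V \<times> insert h H"
    by (rule permutes_subset, use insert.IH M in auto)+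
  have "permutation (?F H)" "permutation ?M"
    using P V insert.hyps(1) by (auto intro!: permutation_permutes[THEN iffD2] exI[of _ "V \<times> insert h H"])
  then have "sign (?F (insert h H)) = sign ?M * sign (?F H)" unfolding eq by (rule sign_compose[rotated])
  also have "sign ?M = sign s" by (rule sign_map_permutation[OF inj s V])
  also have "sign (?F H) = sign s ^ card H" using insert.IH by (rule conjunct2)
  also have "sign s * sign s ^ card H = sign s ^ card (insert h H)"
    using insert.hyps by simp
  finally have "sign (?F (insert h H)) = sign s ^ card (insert h H)" .
  moreover have "?F (insert h H) permutes V \<times> insert h H"
    unfolding eq by (rule permutes_compose[OF P])
  ultimately show ?case by (intro conjI)
qed

text \<open>The permutation factors into parallel copies of \<open>s\<close>, one for each group
  element, and a pure twist by \<open>b\<close>. Oddness matters: for a group of order 2 and a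
  single vertex, the twist by the involution is a transposition.\<close>

lemma (in group) sign_wreath_perm:
  assumes V: "finite V" and G: "finite (carrier G)" "odd (card (carrier G))"
    and s: "s permutes V" and b: "b \<in> V \<rightarrow> carrier G"
  shows "sign (wreath_perm V G s b) = sign s ^ card (carrier G)"
proof -
  \<comment> \<open>a square root of b, so that twisting by b is a square and hence even\<close>
  define c where "c x = b x [^] ((card (carrier G) + 1) div 2)" for x
  have c: "c \<in> V \<rightarrow> carrier G" using b by (auto simp: c_def intro!: nat_pow_closed)
  have perm: "permutation (wreath_perm V G t d)" if "t permutes V" "d \<in> V \<rightarrow> carrier G" for t d
    using wreath_perm_permutes[OF V G(1) that] V G(1) by (auto simp: permutation_permutes)
  have cc: "c x \<otimes> c x = b x" if "x \<in> V" for x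
  proof -
    have bx: "b x \<in> carrier G" using b that by auto
    have "c x \<otimes> c x = b x [^] ((card (carrier G) + 1) div 2 + (card (carrier G) + 1) div 2)"
      by (simp add: c_def nat_pow_mult bx)
    also have "(card (carrier G) + 1) div 2 + (card (carrier G) + 1) div 2 = card (carrier G) + 1"
      using G(2) by presburger
    also have "b x [^] (card (carrier G) + 1) = b x"
      using bx pow_order_eq_1[OF bx] by (simp add: Coset.order_def)
    finally show ?thesis .
  qed
  have "wreath_perm V G id b = wreath_perm V G id c \<circ> wreath_perm V G id c"
    using cc c b by (auto simp: wreath_perm_def fun_eq_iff m_assoc Pi_iff)
  then have 1: "sign (wreath_perm V G id b) = 1"
    using sign_compose[OF perm perm] c by (simp add: permutes_id)
  let ?F = "\<lambda>(x, g). if x \<in> V \<and> g \<in> carrier G then (s x, g) else (x, g)"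
  have F: "?F permutes V \<times> carrier G" "sign ?F = sign s ^ card (carrier G)"
    by (fact sign_on_copies[OF V s G(1), THEN conjunct1] sign_on_copies[OF V s G(1), THEN conjunct2])+
  have "wreath_perm V G s b = ?F \<circ> wreath_perm V G id b"
    using b by (auto simp: wreath_perm_def fun_eq_iff Pi_iff)
  moreover have "permutation ?F" using F(1) V G(1) by (auto simp: permutation_permutes)
  ultimately have "sign (wreath_perm V G s b) = sign ?F * sign (wreath_perm V G id b)"
    using sign_compose[OF _ perm] b by (simp add: permutes_id)
  then show ?thesis using 1 F(2) by simp
qed

text \<open>Equivariance determines \<sigma> by its values at the points (x, 1), from which
  \<open>s\<close> and \<open>b\<close> are read off. If s x = s y, a suitable translate of (y, 1)
  has the same image as (x, 1), so injectivity of \<sigma> gives that of \<open>s\<close>.\<close>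

lemma (in group) equivariant_perm_is_wreath_perm:
  assumes V: "finite V" and \<sigma>: "\<sigma> permutes V \<times> carrier G"
    and eqv: "\<And>x g h. x \<in> V \<Longrightarrow> g \<in> carrier G \<Longrightarrow> h \<in> carrier G \<Longrightarrow>
      \<sigma> (x, g \<otimes> h) = (fst (\<sigma> (x, h)), g \<otimes> snd (\<sigma> (x, h)))"
  shows "\<exists>s b. s permutes V \<and> b \<in> V \<rightarrow>\<^sub>E carrier G \<and> \<sigma> = wreath_perm V G s b"
proof -
  define s where "s x = (if x \<in> V then fst (\<sigma> (x, \<one>)) else x)" for x
  define b where "b = (\<lambda>x\<in>V. snd (\<sigma> (x, \<one>)))"
  have in1: "\<sigma> (x, \<one>) \<in> V \<times> carrier G" if "x \<in> V" for x
    using permutes_in_image[OF \<sigma>] that by blast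
  have b: "b \<in> V \<rightarrow>\<^sub>E carrier G" using in1 by (auto simp: b_def mem_Times_iff)
  have \<sigma>_eq: "\<sigma> (x, g) = (s x, g \<otimes> b x)" if "x \<in> V" "g \<in> carrier G" for x g
    using eqv[of x g \<one>] that by (simp add: s_def b_def)
  have "inj_on s V"
  proof (rule inj_onI)
    fix x y assume xy: "x \<in> V" "y \<in> V" "s x = s y"
    have bxy: "b x \<in> carrier G" "b y \<in> carrier G" using b xy by auto
    then have "\<sigma> (y, b x \<otimes> inv (b y)) = \<sigma> (x, \<one>)"
      using xy by (simp add: \<sigma>_eq m_assoc)
    then show "x = y" using permutes_inj[OF \<sigma>] by (auto simp: inj_eq)
  qed
  moreover have "s ` V \<subseteq> V" using in1 by (auto simp: s_def mem_Times_iff)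
  ultimately have "bij_betw s V V" using V by (simp add: bij_betw_def endo_inj_surj)
  then have s: "s permutes V" by (rule bij_imp_permutes) (simp add: s_def)
  have "\<sigma> z = wreath_perm V G s b z" for z
    using permutes_not_in[OF \<sigma>, of z] by (cases z) (auto simp: wreath_perm_def \<sigma>_eq)
  then show ?thesis using s b by blast
qed

text \<open>The group acts on the permutations of \<open>V \<times> G\<close> by conjugation with left translations, and
  the Leibniz summands are constant on orbits; so in characteristic p only the equivariant
  permutations contribute.\<close>

lemma (in group) det_on_group_matrix:
  fixes a :: "'v \<Rightarrow> 'v \<Rightarrow> 'a \<Rightarrow> 'r::comm_ring_1"
  assumes p: "prime p" "of_nat p = (0 :: 'r)" and G: "finite (carrier G)" "card (carrier G) = p ^ n"
    and V: "finite V"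
  shows "det_on (V \<times> carrier G) (\<lambda>(x, g) (y, h). a x y (inv g \<otimes> h))
    = det_on V (\<lambda>x y. \<Sum>u\<in>carrier G. a x y u) ^ card (carrier G)"
proof -
  let ?X = "V \<times> carrier G"
  define M where "M = (\<lambda>(x, g) (y, h). a x y (inv g \<otimes> h))"
  define L where "L g = (\<lambda>(x, h). if x \<in> V \<and> h \<in> carrier G then (x, g \<otimes> h) else (x, h))" for g
  define t where "t \<sigma> = of_int (sign \<sigma>) * (\<Prod>z\<in>?X. M z (\<sigma> z))" for \<sigma>
  define E where "E = {\<sigma>. \<sigma> permutes ?X}"
  have X: "finite ?X" using V G(1) by simp
  have L1: "L \<one> = id" by (auto simp: L_def fun_eq_iff)
  have Lm: "L (g \<otimes> h) = L g \<circ> L h" if "g \<in> carrier G" "h \<in> carrier G" for g h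
    using that by (auto simp: L_def fun_eq_iff m_assoc)
  have Linv: "L g (L (inv g) z) = z" "L (inv g) (L g z) = z" if "g \<in> carrier G" for g z
    using that by (cases z; simp add: L_def flip: m_assoc)+
  have Lin: "L g z \<in> ?X" if "g \<in> carrier G" "z \<in> ?X" for g z
    using that by (auto simp: L_def)
  have Lperm: "L g permutes ?X" if "g \<in> carrier G" for g
  proof (rule bij_imp_permutes)
    show "bij_betw (L g) ?X ?X"
      by (rule bij_betw_byWitness[where f' = "L (inv g)"])
         (use Linv[OF that] Lin[OF that] Lin[OF inv_closed[OF that]] in blast)+
  qed (auto simp: L_def split: if_splits)
  define \<phi> where "\<phi> g \<sigma> = L g \<circ> \<sigma> \<circ> L (inv g)" for g \<sigma>
  have \<phi>E: "\<phi> g \<sigma> \<in> E" if "g \<in> carrier G" "\<sigma> \<in> E" for g \<sigma>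
    using permutes_compose[OF Lperm[of "inv g"] permutes_compose[OF _ Lperm[of g], of \<sigma>]] that
    by (simp add: \<phi>_def E_def)
  have act: "group_action G E (\<lambda>g. restrict (\<phi> g) E)"
  proof (rule group_actionI)
    show "\<phi> \<one> \<sigma> = \<sigma>" for \<sigma> by (simp add: \<phi>_def L1)
    show "\<phi> (g \<otimes> h) \<sigma> = \<phi> g (\<phi> h \<sigma>)" if "g \<in> carrier G" "h \<in> carrier G" for g h \<sigma>
      using that by (simp add: \<phi>_def Lm inv_mult_group comp_assoc)
  qed (rule \<phi>E)
  have finE: "finite E" unfolding E_def by (rule finite_permutations[OF X])
  \<comment> \<open>The signs of the translations by g and its inverse cancel. The entries depend
    only on the quotient of the two group coordinates, so reindexing the product by
    \<open>L g\<close> absorbs the conjugation.\<close>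
  have t_inv: "t (\<phi> g \<sigma>) = t \<sigma>" if g: "g \<in> carrier G" and \<sigma>: "\<sigma> \<in> E" for g \<sigma>
  proof -
    have perm: "permutation (L g)" "permutation (L (inv g))" "permutation \<sigma>"
      using Lperm g \<sigma> X by (auto simp: permutation_permutes E_def)
    have "sign (L g) * sign (L (inv g)) = sign (L g \<circ> L (inv g))" by (simp add: sign_compose perm)
    also have "\<dots> = 1" using Lm[of g "inv g"] g L1 by simp
    finally have "sign (L g) * sign (L (inv g)) = 1" .
    then have sg: "sign (\<phi> g \<sigma>) = sign \<sigma>"
      unfolding \<phi>_def using perm by (simp add: sign_compose permutation_compose mult_ac)
    have M_inv: "M (L g z) (L g z') = M z z'" if "z \<in> ?X" "z' \<in> ?X" for z z'
    proof -
      have "inv (g \<otimes> h) \<otimes> (g \<otimes> h') = inv h \<otimes> h'" if "h \<in> carrier G" "h' \<in> carrier G" for h h'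
      proof -
        have "inv g \<otimes> (g \<otimes> h') = h'" using that g by (simp flip: m_assoc)
        then show ?thesis using that g by (simp add: inv_mult_group m_assoc)
      qed
      then show ?thesis using that by (auto simp: M_def L_def)
    qed
    have "(\<Prod>z\<in>?X. M z (\<phi> g \<sigma> z)) = (\<Prod>z\<in>?X. M (L g z) (\<phi> g \<sigma> (L g z)))"
      by (rule prod.permute[OF Lperm[OF g], unfolded o_def])
    also have "\<dots> = (\<Prod>z\<in>?X. M z (\<sigma> z))"
      using g \<sigma> by (intro prod.cong refl) (auto simp: \<phi>_def Linv E_def permutes_in_image intro!: M_inv)
    finally show ?thesis by (simp add: t_def sg)
  qed
  define W where "W = (\<lambda>(s, b). wreath_perm V G s b)"
  let ?I = "{s. s permutes V} \<times> (V \<rightarrow>\<^sub>E carrier G)"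
  have fixed: "{\<sigma> \<in> E. \<forall>g\<in>carrier G. restrict (\<phi> g) E \<sigma> = \<sigma>} = W ` ?I"
  proof safe
    fix \<sigma> assume \<sigma>: "\<sigma> \<in> E" and f: "\<forall>g\<in>carrier G. restrict (\<phi> g) E \<sigma> = \<sigma>"
    have "\<sigma> (x, g \<otimes> h) = (fst (\<sigma> (x, h)), g \<otimes> snd (\<sigma> (x, h)))"
      if "x \<in> V" "g \<in> carrier G" "h \<in> carrier G" for x g h
    proof -
      have "\<sigma> (x, g \<otimes> h) = \<sigma> (L g (x, h))" using that by (simp add: L_def)
      also have "\<dots> = \<phi> g \<sigma> (L g (x, h))" using f \<sigma> that(2) by simp
      also have "\<dots> = L g (\<sigma> (x, h))" using that by (simp add: \<phi>_def Linv)
      also have "\<dots> = (fst (\<sigma> (x, h)), g \<otimes> snd (\<sigma> (x, h)))"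
      proof -
        have "\<sigma> (x, h) \<in> ?X" using \<sigma> that permutes_in_image[of \<sigma> ?X] by (auto simp: E_def)
        then show ?thesis by (cases "\<sigma> (x, h)") (auto simp: L_def)
      qed
      finally show ?thesis .
    qed
    then show "\<sigma> \<in> W ` ?I"
      using equivariant_perm_is_wreath_perm[OF V, of \<sigma>] \<sigma> by (auto simp: E_def W_def)
  next
    fix s b assume sb: "s permutes V" "b \<in> V \<rightarrow>\<^sub>E carrier G"
    have b: "b x \<in> carrier G" if "x \<in> V" for x using sb that by auto
    have b': "b \<in> V \<rightarrow> carrier G" using sb by auto
    show WE: "W (s, b) \<in> E"
      using wreath_perm_permutes[OF V G(1) sb(1) b'] by (simp add: E_def W_def)
    fix g assume g: "g \<in> carrier G"
    have "\<phi> g (W (s, b)) z = W (s, b) z" for z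
      using g b permutes_in_image[OF sb(1)]
      by (cases z) (auto simp: \<phi>_def W_def L_def wreath_perm_def simp flip: m_assoc)
    then show "restrict (\<phi> g) E (W (s, b)) = W (s, b)" using WE by auto
  qed
  have inj: "inj_on W ?I"
  proof (rule inj_onI, clarify)
    fix s b s' b' assume A: "s permutes V" "b \<in> V \<rightarrow>\<^sub>E carrier G" "s' permutes V" "b' \<in> V \<rightarrow>\<^sub>E carrier G"
      "W (s, b) = W (s', b')"
    have "s x = s' x \<and> b x = b' x" if "x \<in> V" for x
    proof -
      have "b x \<in> carrier G" "b' x \<in> carrier G" using A that by auto
      then show ?thesis
        using fun_cong[OF A(5), of "(x, \<one>)"] that by (simp add: W_def wreath_perm_def)
    qed
    moreover have "s x = s' x" if "x \<notin> V" for x using A that by (simp add: permutes_not_in)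
    ultimately show "s = s' \<and> b = b'"
      using A by (metis (no_types, lifting) PiE_ext ext)
  qed
  have char: "CHAR('r) = p" by (rule CHAR_eq_prime[OF p])
  \<comment> \<open>Raising to the power |G| = p ^ n is an iterated Frobenius map, hence
    additive.\<close>
  have frob_sum: "(\<Sum>i\<in>A. h i) ^ card (carrier G) = (\<Sum>i\<in>A. h i ^ card (carrier G))" for A and h :: "'i \<Rightarrow> 'r"
    using freshmans_dream_sum'[of "card (carrier G)" n h A] p(1) char G(2) by simp
  \<comment> \<open>For odd |G| this is the sign formula over the integers. For even |G| that
    formula can fail, but p = 2 makes 1 and -1 equal in the ring.\<close>
  have sgn: "of_int (sign (W (s, b))) = (of_int (sign s) :: 'r) ^ card (carrier G)"
    if "s permutes V" "b \<in> V \<rightarrow>\<^sub>E carrier G" for s b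
  proof (cases "odd (card (carrier G))")
    case True
    have "b \<in> V \<rightarrow> carrier G" using that(2) by (simp add: PiE_def)
    then show ?thesis using sign_wreath_perm[OF V G(1) True that(1)] by (simp add: W_def)
  next
    case False
    then have "p = 2" using p(1) G(2) by (metis dvd_power_same even_power primes_dvd_imp_eq two_is_prime_nat)
    then have "(1::'r) + 1 = 0" using p(2) by simp
    then have "(-1::'r) = 1" by (simp add: eq_neg_iff_add_eq_0)
    then have "of_int (sign \<sigma>) = (1 :: 'r)" "of_int (sign s) = (1 :: 'r)" for \<sigma> :: "'v \<times> 'a \<Rightarrow> 'v \<times> 'a"
      by (simp_all add: sign_def)
    then show ?thesis by simp
  qed
  have "det_on ?X M = sum t E" by (simp add: det_on_def t_def E_def)
  also have "\<dots> = sum t {\<sigma> \<in> E. \<forall>g\<in>carrier G. restrict (\<phi> g) E \<sigma> = \<sigma>}"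
    by (rule group_action.sum_eq_sum_fixed_points[OF act p G(2) finE]) (simp add: t_inv)
  also have "\<dots> = sum t (W ` ?I)" by (simp only: fixed)
  also have "\<dots> = (\<Sum>(s, b)\<in>?I. t (W (s, b)))"
    using sum.reindex[OF inj, of t] by (simp add: case_prod_unfold o_def)
  also have "\<dots> = (\<Sum>(s, b)\<in>?I. of_int (sign s) ^ card (carrier G) * (\<Prod>x\<in>V. a x (s x) (b x) ^ card (carrier G)))"
  proof (intro sum.cong refl, clarify)
    fix s b assume sb: "s permutes V" "b \<in> V \<rightarrow>\<^sub>E carrier G"
    have "(\<Prod>z\<in>?X. M z (W (s, b) z)) = (\<Prod>(x, g)\<in>?X. a x (s x) (b x))"
    proof (intro prod.cong refl, clarify)
      fix x g assume "x \<in> V" "g \<in> carrier G"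
      moreover from this have "b x \<in> carrier G" using sb by auto
      ultimately show "M (x, g) (W (s, b) (x, g)) = a x (s x) (b x)"
        by (simp add: M_def W_def wreath_perm_def flip: m_assoc)
    qed
    also have "\<dots> = (\<Prod>x\<in>V. a x (s x) (b x) ^ card (carrier G))"
      by (simp flip: prod.cartesian_product)
    finally show "t (W (s, b)) = of_int (sign s) ^ card (carrier G) * (\<Prod>x\<in>V. a x (s x) (b x) ^ card (carrier G))"
      by (simp add: t_def sgn[OF sb])
  qed
  also have "\<dots> = (\<Sum>s | s permutes V. of_int (sign s) ^ card (carrier G)
      * (\<Sum>b\<in>V \<rightarrow>\<^sub>E carrier G. \<Prod>x\<in>V. a x (s x) (b x) ^ card (carrier G)))"
    by (simp add: sum_distrib_left flip: sum.cartesian_product)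
  also have "\<dots> = (\<Sum>s | s permutes V. of_int (sign s) ^ card (carrier G)
      * (\<Prod>x\<in>V. \<Sum>u\<in>carrier G. a x (s x) u ^ card (carrier G)))"
    by (intro sum.cong refl arg_cong2[where f = "(*)"] prod_sum_PiE[symmetric] V G(1))
  also have "\<dots> = (\<Sum>s | s permutes V. (of_int (sign s) * (\<Prod>x\<in>V. \<Sum>u\<in>carrier G. a x (s x) u)) ^ card (carrier G))"
    by (simp add: power_mult_distrib prod_power_distrib frob_sum)
  also have "\<dots> = det_on V (\<lambda>x y. \<Sum>u\<in>carrier G. a x y u) ^ card (carrier G)"
    by (simp add: det_on_def frob_sum)
  finally show ?thesis by (simp add: M_def)
qed

section \<open>Spectral matrices and reduction\<close>

text \<open>Reduction modulo the maximal ideal is only a partial map, so it is treated as a relation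
  compatible with the ring operations; such relations lift to power series, polynomials and
  determinants.\<close>

locale ring_rel =
  fixes S :: "'a::comm_ring_1 \<Rightarrow> 'b::comm_ring_1 \<Rightarrow> bool"
  assumes zero: "S 0 0" and one: "S 1 1"
    and add: "S x y \<Longrightarrow> S x' y' \<Longrightarrow> S (x + x') (y + y')"
    and uminus: "S x y \<Longrightarrow> S (- x) (- y)"
    and mult: "S x y \<Longrightarrow> S x' y' \<Longrightarrow> S (x * x') (y * y')"
begin

lemma diff: "S x y \<Longrightarrow> S x' y' \<Longrightarrow> S (x - x') (y - y')"
  using add[of x y "- x'" "- y'"] uminus[of x' y'] by simp

lemma sum: "(\<And>i. i \<in> I \<Longrightarrow> S (f i) (g i)) \<Longrightarrow> S (sum f I) (sum g I)"
  by (induction I rule: infinite_finite_induct) (auto intro: zero add)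

lemma prod: "(\<And>i. i \<in> I \<Longrightarrow> S (f i) (g i)) \<Longrightarrow> S (prod f I) (prod g I)"
  by (induction I rule: infinite_finite_induct) (auto intro: one mult)

lemma of_nat: "S (of_nat n) (of_nat n)"
  by (induction n) (auto intro: zero one add)

lemma of_int: "S (of_int n) (of_int n)"
  by (cases n rule: int_cases2) (auto intro: of_nat uminus)

lemma det_on:
  assumes "\<And>x y. x \<in> V \<Longrightarrow> y \<in> V \<Longrightarrow> S (M x y) (N x y)"
  shows "S (det_on V M) (det_on V N)"
  unfolding det_on_def
  by (intro sum mult of_int prod) (use assms in \<open>auto simp: permutes_in_image\<close>)

lemma det:
  assumes A: "A \<in> carrier_mat n n" and B: "B \<in> carrier_mat n n"
    and "\<And>i j. i < n \<Longrightarrow> j < n \<Longrightarrow> S (A $$ (i, j)) (B $$ (i, j))"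
  shows "S (Determinant.det A) (Determinant.det B)"
  unfolding det_on_eq_det[OF A, symmetric] det_on_eq_det[OF B, symmetric]
  by (rule det_on) (use assms in auto)

text \<open>The equal degrees make the two Sylvester matrices the same size and shape;
  coefficientwise related polynomials alone could lose their leading terms.\<close>

lemma resultant:
  assumes "\<And>i. S (coeff p i) (coeff p' i)" "\<And>i. S (coeff q i) (coeff q' i)"
    and "degree p' = degree p" "degree q' = degree q"
  shows "S (resultant p q) (resultant p' q')"
  unfolding resultant_def
proof (rule det)
  fix i j assume "i < degree p + degree q" "j < degree p + degree q"
  then show "S (sylvester_mat p q $$ (i, j)) (sylvester_mat p' q' $$ (i, j))"
    using assms by (auto simp: sylvester_index_mat zero)
qed (use assms in \<open>auto simp: sylvester_mat_def sylvester_mat_sub_def\<close>)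

end

definition poly_rel :: "('a::zero \<Rightarrow> 'b::zero \<Rightarrow> bool) \<Rightarrow> 'a poly \<Rightarrow> 'b poly \<Rightarrow> bool" where
  "poly_rel S p q \<longleftrightarrow> (\<forall>i. S (coeff p i) (coeff q i))"

definition mps_rel :: "('a \<Rightarrow> 'b \<Rightarrow> bool) \<Rightarrow> ('d, 'a) mps \<Rightarrow> ('d, 'b) mps \<Rightarrow> bool" where
  "mps_rel S f g \<longleftrightarrow> (\<forall>n. S (mps_coeff f n) (mps_coeff g n))"

context ring_rel
begin

lemma ring_rel_poly: "ring_rel (poly_rel S)"
  by unfold_locales
     (auto simp: poly_rel_def coeff_1 coeff_mult
        intro!: zero one add uminus mult sum)

lemma ring_rel_mps: "ring_rel (mps_rel S :: ('d::finite, 'a) mps \<Rightarrow> ('d, 'b) mps \<Rightarrow> bool)"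
  by unfold_locales
     (auto simp: mps_rel_def mps_coeff_1 mps_coeff_mult case_prod_unfold
        intro!: zero one add uminus mult sum)

lemma poly_rel_monom: "S c d \<Longrightarrow> poly_rel S (monom c n) (monom d n)"
  by (simp add: poly_rel_def zero)

lemma poly_rel_const: "S c d \<Longrightarrow> poly_rel S [:c:] [:d:]"
  by (simp add: poly_rel_def coeff_pCons zero split: nat.split)

lemma mps_rel_const: "S c d \<Longrightarrow> mps_rel S (mps_const c) (mps_const d)"
  by (simp add: mps_rel_def mps_coeff_const zero)

text \<open>A leading coefficient 1 cannot disappear, provided 0 and 1 are related to nothing but 0
  and 1 respectively.\<close>

lemma poly_rel_degree:
  assumes "poly_rel S p q" "lead_coeff p = 1" and S01: "\<And>y. S 0 y \<Longrightarrow> y = 0" "\<And>y. S 1 y \<Longrightarrow> y = 1"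
  shows "degree q = degree p" "lead_coeff q = 1"
proof -
  have "coeff q i = 0" if "i > degree p" for i
    using assms(1) S01(1) that by (metis coeff_eq_0 poly_rel_def)
  moreover have 1: "coeff q (degree p) = 1" using assms S01(2) by (metis poly_rel_def)
  ultimately show "degree q = degree p"
    by (intro antisym degree_le le_degree) auto
  then show "lead_coeff q = 1" using 1 by simp
qed

end

text \<open>The matrix inside \<open>spectral_poly\<close>, with arc entries \<open>W\<close> and
  diagonal \<open>D\<close> taken from an arbitrary commutative ring, so that the same formula
  serves over K and over the residue field.\<close>

definition spectral_matrix ::
  "('v, 'e) pre_digraph \<Rightarrow> ('e \<Rightarrow> 'm::comm_ring_1) \<Rightarrow> ('v \<Rightarrow> 'm) \<Rightarrow> 'v \<Rightarrow> 'v \<Rightarrow> 'm poly" where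
  "spectral_matrix Z W D x y =
     (if x = y then monom 1 2 else 0)
       - monom (\<Sum>e | e \<in> arcs Z \<and> tail Z e = x \<and> head Z e = y. W e) 1
       + (if x = y then [: D x :] else 0) - (if x = y then 1 else 0)"

lemma spectral_poly_eq:
  "spectral_poly \<iota> Z w \<alpha> = det_on (verts Z)
     (spectral_matrix Z (\<lambda>e. mps_const (w e) * tau \<iota> (\<alpha> e)) (\<lambda>x. mps_const (\<Sum>e\<in>out_arcs Z x. w e)))"
  by (simp only: spectral_poly_def spectral_matrix_def[abs_def] weight_matrix_def)

lemma (in ring_rel) spectral_matrix:
  assumes "\<And>e. e \<in> arcs Z \<Longrightarrow> S (W e) (W' e)" and "S (D x) (D' x)"
  shows "poly_rel S (spectral_matrix Z W D x y) (spectral_matrix Z W' D' x y)"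
proof -
  interpret P: ring_rel "poly_rel S" by (rule ring_rel_poly)
  have "S (\<Sum>e | e \<in> arcs Z \<and> tail Z e = x \<and> head Z e = y. W e)
     (\<Sum>e | e \<in> arcs Z \<and> tail Z e = x \<and> head Z e = y. W' e)"
    using assms(1) by (intro sum) auto
  moreover have "S (D x) (D' x)" by (rule assms)
  ultimately show ?thesis unfolding spectral_matrix_def
    by (intro P.diff P.add) (auto intro!: P.zero P.one poly_rel_monom poly_rel_const one)
qed

lemma coeff_mult_degree_le:
  fixes p q :: "'a::comm_ring_1 poly"
  assumes "degree p \<le> m" "degree q \<le> n"
  shows "coeff (p * q) (m + n) = coeff p m * coeff q n"
proof -
  have "coeff p i * coeff q (m + n - i) = (if i = m then coeff p m * coeff q n else 0)" for i
    using assms by (cases i m rule: linorder_cases) (auto simp: coeff_eq_0)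
  then show ?thesis by (simp add: coeff_mult)
qed

text \<open>Diagonal entries are monic of degree 2 and the others have degree at most 1, so among
  the Leibniz summands only that of the identity reaches degree 2 * card V.\<close>

lemma det_on_spectral_matrix_monic:
  fixes W :: "'e \<Rightarrow> 'm::comm_ring_1"
  assumes V: "finite V"
  shows "lead_coeff (det_on V (spectral_matrix Z W D)) = 1"
proof -
  let ?M = "spectral_matrix Z W D"
  let ?n = "2 * card V"
  have diag: "degree (?M x x) \<le> 2" "coeff (?M x x) 2 = 1" for x
    by (auto simp: spectral_matrix_def coeff_pCons coeff_1
        intro!: degree_diff_le degree_add_le degree_monom_le order_trans[OF degree_monom_le] split: nat.split)
  have off: "degree (?M x y) \<le> 1" if "x \<noteq> y" for x y
    using that by (auto simp: spectral_matrix_def intro!: degree_monom_le)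
  have coeff_prod: "coeff (\<Prod>x\<in>A. h x) (2 * card A) = (\<Prod>x\<in>A. coeff (h x) 2) \<and> degree (\<Prod>x\<in>A. h x) \<le> 2 * card A"
    if "finite A" "\<And>x. x \<in> A \<Longrightarrow> degree (h x) \<le> 2" for h :: "'a \<Rightarrow> 'm poly" and A
    using that
  proof (induction A rule: finite_induct)
    case (insert x A)
    have "coeff (h x * prod h A) (2 + 2 * card A) = coeff (h x) 2 * coeff (prod h A) (2 * card A)"
      using insert by (intro coeff_mult_degree_le) auto
    moreover have "degree (h x * prod h A) \<le> 2 + 2 * card A"
      using insert by (intro order_trans[OF degree_mult_le] add_mono) auto
    ultimately show ?case using insert by simp
  qed simp
  have deg2: "degree (?M x y) \<le> 2" for x y using diag(1)[of x] off[of x y] by (cases "x = y") auto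
  have *: "coeff (\<Prod>x\<in>V. ?M x (\<sigma> x)) ?n = (if \<sigma> = id then 1 else 0)" if "\<sigma> permutes V" for \<sigma>
  proof (cases "\<sigma> = id")
    case False
    then obtain x where x: "\<sigma> x \<noteq> x" by (auto simp: fun_eq_iff)
    then have "x \<in> V" using that by (metis permutes_not_in)
    moreover have "coeff (?M x (\<sigma> x)) 2 = 0" using off[of x "\<sigma> x"] x by (intro coeff_eq_0) auto
    ultimately have "(\<Prod>x\<in>V. coeff (?M x (\<sigma> x)) 2) = 0" using V by (intro prod_zero) auto
    then show ?thesis using coeff_prod[OF V, of "\<lambda>x. ?M x (\<sigma> x)"] deg2 False by simp
  qed (use coeff_prod[OF V, of "\<lambda>x. ?M x x"] diag deg2 in simp)
  have "coeff (det_on V ?M) ?n = (\<Sum>\<sigma> | \<sigma> permutes V. if \<sigma> = id then 1 else 0)"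
    unfolding det_on_def coeff_sum
  proof (intro sum.cong refl)
    fix \<sigma> assume "\<sigma> \<in> {\<sigma>. \<sigma> permutes V}"
    then show "coeff (of_int (sign \<sigma>) * (\<Prod>x\<in>V. ?M x (\<sigma> x))) ?n = (if \<sigma> = id then 1 else 0)"
      using * by (auto simp: of_int_poly)
  qed
  also have "\<dots> = 1" using finite_permutations[OF V] by (simp add: permutes_id)
  finally have 1: "coeff (det_on V ?M) ?n = 1" .
  have "degree (det_on V ?M) \<le> ?n"
    unfolding det_on_def
  proof (rule degree_sum_le[OF finite_permutations[OF V]])
    fix \<sigma>
    show "degree (of_int (sign \<sigma>) * (\<Prod>x\<in>V. ?M x (\<sigma> x))) \<le> ?n"
      using coeff_prod[OF V, of "\<lambda>x. ?M x (\<sigma> x)"] deg2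
      by (intro order_trans[OF degree_mult_le]) (simp add: of_int_poly)
  qed
  then have "degree (det_on V ?M) = ?n" using 1 by (intro antisym le_degree) auto
  then show ?thesis using 1 by simp
qed

lemma det_on_cong:
  assumes "\<And>x y. x \<in> V \<Longrightarrow> y \<in> V \<Longrightarrow> M x y = N x y"
  shows "det_on V M = det_on V N"
  unfolding det_on_def using assms
  by (intro sum.cong refl arg_cong2[where f = "(*)"] prod.cong) (auto simp: permutes_in_image)

lemma of_nat_poly_mps_eq_0:
  "of_nat p = (0 :: 'a::comm_ring_1) \<Longrightarrow> of_nat p = (0 :: ('d::finite, 'a) mps poly)"
  by (auto simp: of_nat_poly of_nat_mps mps_coeff_const intro!: mps_eqI)

text \<open>Arcs of the cover from (x, g) to (y, h) are the lifts of arcs e from x to y with \<beta>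
  e = inv g \<otimes> h, which exhibits a group matrix. Summing its entries over G forgets \<beta>
  and returns the matrix of the base.\<close>

lemma det_on_spectral_matrix_derived:
  fixes W :: "'e \<Rightarrow> ('d::finite, 'r::comm_ring_1) mps" and G :: "('g, 'm) monoid_scheme"
  assumes X: "fin_digraph \<X>" and G: "group G" "finite (carrier G)" "card (carrier G) = p ^ n"
    and p: "prime p" "of_nat p = (0 :: 'r)" and \<beta>: "\<And>e. e \<in> arcs \<X> \<Longrightarrow> \<beta> e \<in> carrier G"
  shows "det_on (verts (derived_digraph \<X> G \<beta>)) (spectral_matrix (derived_digraph \<X> G \<beta>) (W \<circ> fst) (D \<circ> fst))
    = det_on (verts \<X>) (spectral_matrix \<X> W D) ^ card (carrier G)"
proof -
  interpret X: fin_digraph \<X> by (rule X)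
  interpret G: group G by (rule G)
  \<comment> \<open>The terms on the diagonal of the cover sit at the neutral element, since (x, g)
    = (y, h) means x = y and inv g \<otimes> h = \<one>.\<close>
  define a where "a x y u = (if x = y \<and> u = \<one>\<^bsub>G\<^esub> then monom 1 2 + [:D x:] - 1 else 0)
    - monom (\<Sum>e | e \<in> arcs \<X> \<and> tail \<X> e = x \<and> head \<X> e = y \<and> \<beta> e = u. W e) 1" for x y u
  have "det_on (verts (derived_digraph \<X> G \<beta>)) (spectral_matrix (derived_digraph \<X> G \<beta>) (W \<circ> fst) (D \<circ> fst))
      = det_on (verts \<X> \<times> carrier G) (\<lambda>(x, g) (y, h). a x y (inv\<^bsub>G\<^esub> g \<otimes>\<^bsub>G\<^esub> h))"
    unfolding derived_digraph_def pre_digraph.simps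
  proof (rule det_on_cong, clarify)
    fix x g y h assume gh: "g \<in> carrier G" "h \<in> carrier G"
    let ?Y = "\<lparr>verts = verts \<X> \<times> carrier G, arcs = arcs \<X> \<times> carrier G, tail = \<lambda>(e, g). (tail \<X> e, g),
         head = \<lambda>(e, g). (head \<X> e, g \<otimes>\<^bsub>G\<^esub> \<beta> e)\<rparr>"
    have canc: "inv\<^bsub>G\<^esub> g \<otimes>\<^bsub>G\<^esub> (g \<otimes>\<^bsub>G\<^esub> u) = u" "g \<otimes>\<^bsub>G\<^esub> (inv\<^bsub>G\<^esub> g \<otimes>\<^bsub>G\<^esub> u) = u"
      if "u \<in> carrier G" for u
      using gh that by (simp_all flip: G.m_assoc)
    have "(\<Sum>e | e \<in> arcs ?Y \<and> tail ?Y e = (x, g) \<and> head ?Y e = (y, h). (W \<circ> fst) e)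
        = (\<Sum>e | e \<in> arcs \<X> \<and> tail \<X> e = x \<and> head \<X> e = y \<and> \<beta> e = inv\<^bsub>G\<^esub> g \<otimes>\<^bsub>G\<^esub> h. W e)"
      by (rule sum.reindex_bij_witness[where i = "\<lambda>e. (e, g)" and j = fst]) (auto simp: canc \<beta> gh)
    moreover have "(x, g) = (y, h) \<longleftrightarrow> x = y \<and> inv\<^bsub>G\<^esub> g \<otimes>\<^bsub>G\<^esub> h = \<one>\<^bsub>G\<^esub>"
      using gh by (metis G.inv_closed G.inv_equality G.inv_inv G.l_inv prod.inject)
    ultimately show "spectral_matrix ?Y (W \<circ> fst) (D \<circ> fst) (x, g) (y, h) = a x y (inv\<^bsub>G\<^esub> g \<otimes>\<^bsub>G\<^esub> h)"
      by (simp add: spectral_matrix_def a_def)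
  qed
  also have "\<dots> = det_on (verts \<X>) (\<lambda>x y. \<Sum>u\<in>carrier G. a x y u) ^ card (carrier G)"
    by (rule G.det_on_group_matrix[OF p(1) of_nat_poly_mps_eq_0[OF p(2)] G(2,3)]) simp
  also have "(\<lambda>x y. \<Sum>u\<in>carrier G. a x y u) = spectral_matrix \<X> W D"
  proof (intro ext)
    fix x y
    let ?E = "{e. e \<in> arcs \<X> \<and> tail \<X> e = x \<and> head \<X> e = y}"
    have "(\<Sum>u\<in>carrier G. \<Sum>e | e \<in> arcs \<X> \<and> tail \<X> e = x \<and> head \<X> e = y \<and> \<beta> e = u. W e) = sum W ?E"
      using sum.group[of ?E "carrier G" \<beta> W] G(2) \<beta> by (auto simp: conj_assoc)
    moreover have "(\<Sum>u\<in>carrier G. if x = y \<and> u = \<one>\<^bsub>G\<^esub> then monom 1 2 + [:D x:] - 1 else 0)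
        = (if x = y then monom 1 2 + [:D x:] - 1 else 0)"
      using G(2) by (cases "x = y") simp_all
    ultimately show "(\<Sum>u\<in>carrier G. a x y u) = spectral_matrix \<X> W D x y"
      by (simp add: a_def spectral_matrix_def sum_subtractf monom_sum[symmetric])
  qed
  finally show ?thesis .
qed

section \<open>Orders at principal primes\<close>

lemma mem_PIdl_iff_dvd: "f \<in> PIdl\<^bsub>ring_of_type_algebra\<^esub> g \<longleftrightarrow> g dvd (f :: 'a::comm_ring_1)"
  by (auto simp: cgenideal_def ring_of_type_algebra_def dvd_def mult.commute)

lemma PIdl_eq_iff:
  "PIdl\<^bsub>ring_of_type_algebra\<^esub> g = PIdl\<^bsub>ring_of_type_algebra\<^esub> h \<longleftrightarrow> g dvd h \<and> h dvd (g :: 'a::comm_ring_1)"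
  unfolding set_eq_iff mem_PIdl_iff_dvd by (meson dvd_refl dvd_trans)

text \<open>The definition of \<open>ord_at\<close> admits every generator, but two generators
  divide each other, so the same powers divide and \<open>g\<close> alone decides. Cancelling g ^ m
  in the domain bounds the exponent.\<close>

lemma ord_at_PIdl:
  fixes g h :: "'a::idom"
  assumes "g \<noteq> 0" and "\<not> g dvd h"
  shows "ord_at (PIdl\<^bsub>ring_of_type_algebra\<^esub> g) (g ^ m * h) = m"
proof -
  have le: "g ^ n dvd g ^ m * h \<longleftrightarrow> n \<le> m" for n
  proof
    assume n: "g ^ n dvd g ^ m * h"
    show "n \<le> m"
    proof (rule ccontr)
      assume "\<not> n \<le> m"
      then have "g ^ m * g dvd g ^ n" using le_imp_power_dvd[of "Suc m" n g] by (simp add: mult.commute)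
      then have "g ^ m * g dvd g ^ m * h" using n dvd_trans by blast
      then show False using assms by simp
    qed
  qed (simp add: le_imp_power_dvd)
  have "(\<exists>g'. PIdl\<^bsub>ring_of_type_algebra\<^esub> g = PIdl\<^bsub>ring_of_type_algebra\<^esub> g' \<and> g' ^ n dvd g ^ m * h)
      \<longleftrightarrow> n \<le> m" for n
    unfolding le[symmetric] PIdl_eq_iff by (meson dvd_power_same dvd_trans dvd_refl)
  then have "{n. \<exists>g'. PIdl\<^bsub>ring_of_type_algebra\<^esub> g = PIdl\<^bsub>ring_of_type_algebra\<^esub> g'
      \<and> g' ^ n dvd g ^ m * h} = {n. n \<le> m}" by (rule Collect_cong)
  also have "\<dots> = {..m}" by (simp add: atMost_def)
  moreover have "Max {..m} = m" by (rule Max_eqI) auto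
  ultimately show ?thesis by (simp add: ord_at_def)
qed

lemma primeideal_power_mem_iff:
  fixes f :: "'a::comm_ring_1"
  assumes "primeideal I ring_of_type_algebra" "q > 0"
  shows "f ^ q \<in> I \<longleftrightarrow> f \<in> I"
proof
  interpret primeideal I "ring_of_type_algebra :: 'a ring" by fact
  have U: "carrier (ring_of_type_algebra :: 'a ring) = UNIV"
    by (simp add: ring_of_type_algebra_def)
  have m: "a \<otimes>\<^bsub>ring_of_type_algebra\<^esub> b = a * b" for a b :: 'a by (simp add: ring_of_type_algebra_def)
  have one: "1 \<notin> I"
    using I_notcarr one_imp_carrier by (auto simp: ring_of_type_algebra_def)
  show "f \<in> I" if "f ^ q \<in> I"
    using that
  proof (induction q)
    case 0
    then show ?case using one by simp
  next
    case (Suc q)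
    then show ?case using I_prime[of f "f ^ q"] by (auto simp: U m)
  qed
  show "f ^ q \<in> I" if "f \<in> I"
  proof -
    have "f ^ (q - 1) * f \<in> I" using I_l_closed[OF that, of "f ^ (q - 1)"] by (simp add: U m)
    then show ?thesis using assms(2) by (cases q) (auto simp: mult.commute)
  qed
qed

text \<open>If \<open>f\<close> has a nonzero coefficient at the exponent vector \<open>n\<close>,
  the total degree of \<open>n\<close> bounds every m with g ^ m dividing f, so a greatest one
  exists.\<close>

lemma mps_ex_maximal_power_dvd:
  fixes f g :: "('d::finite, 'a::comm_ring_1) mps"
  assumes "mps_coeff g (\<lambda>_. 0) = 0" "f \<noteq> 0"
  shows "\<exists>m h. f = g ^ m * h \<and> \<not> g dvd h"
proof -
  obtain n where n: "mps_coeff f n \<noteq> 0" using assms(2) by (metis mps_eqI mps_coeff_0)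
  have bound: "m \<le> sum n UNIV" if m: "g ^ m dvd f" for m
  proof (rule ccontr)
    assume "\<not> m \<le> sum n UNIV"
    moreover obtain h where "f = g ^ m * h" using m by (rule dvdE)
    ultimately show False using mps_coeff_power_mult_eq_0[OF assms(1), of n m h] n by simp
  qed
  define m where "m = (GREATEST m. g ^ m dvd f)"
  have m: "g ^ m dvd f" unfolding m_def
    by (rule GreatestI_nat[of "\<lambda>m. g ^ m dvd f" 0 "sum n UNIV"]) (use bound in auto)
  then obtain h where h: "f = g ^ m * h" by (rule dvdE)
  have "\<not> g dvd h"
  proof
    assume "g dvd h"
    then have "g ^ Suc m dvd f" unfolding h by (simp add: mult_dvd_mono mult.commute)
    then have "Suc m \<le> m"
      unfolding m_def by (rule Greatest_le_nat[of "\<lambda>m. g ^ m dvd f"]) (rule bound)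
    then show False by simp
  qed
  with h show ?thesis by blast
qed

text \<open>After splitting off the full power of \<open>g\<close>, the cofactor \<open>h\<close> is
  not in the prime ideal \<open>I\<close>, hence neither is h ^ q.\<close>

lemma ord_at_power:
  fixes f g :: "('d::finite, 'a::idom) mps"
  assumes I: "primeideal I ring_of_type_algebra" "I = PIdl\<^bsub>ring_of_type_algebra\<^esub> g" "I \<noteq> {0}"
    and g: "mps_coeff g (\<lambda>_. 0) = 0" and f: "f \<noteq> 0" and q: "q > 0"
  shows "ord_at I (f ^ q) = q * ord_at I f"
proof -
  have g0: "g \<noteq> 0" using I(2,3) by (auto simp: set_eq_iff mem_PIdl_iff_dvd)
  obtain m h where h: "f = g ^ m * h" "\<not> g dvd h"
    using mps_ex_maximal_power_dvd[OF g f] by blast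
  have "\<not> g dvd h ^ q"
    using primeideal_power_mem_iff[OF I(1) q, of h] h(2) by (simp add: I(2) mem_PIdl_iff_dvd)
  moreover have "f ^ q = g ^ (q * m) * h ^ q" by (simp add: h(1) power_mult_distrib power_mult mult.commute)
  ultimately show ?thesis
    using ord_at_PIdl[OF g0] h by (simp add: I(2))
qed

section \<open>Finite extensions of the p-adic numbers\<close>

lemma padic_res_of_nat: "padic_res (of_nat k :: 'p::prime_card padic_int) n = int k mod int CARD('p) ^ n"
  by (induction k) (simp_all add: padic_res_add padic_res_1 mod_simps)

lemma padic_abs_le:
  assumes "padic_res (z :: 'p::prime_card padic_int) M = 0"
  shows "padic_abs z \<le> (1 / real CARD('p)) ^ M"
proof (cases "z = 0")
  case False
  define n where "n = (LEAST n. padic_res z (Suc n) \<noteq> 0)"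
  obtain m where m: "padic_res z m \<noteq> 0"
    using False by (metis padic_int_eqI padic_res_0)
  \<comment> \<open>Residues modulo p ^ 0 are always zero, so the index of a nonzero residue is a
    successor, as the \<open>LEAST\<close> in \<open>padic_abs\<close> expects.\<close>
  have "padic_res z 0 = 0" using padic_res_ge[of z 0] padic_res_less[of z 0] by simp
  with m obtain k where "m = Suc k" by (cases m) auto
  with m have n: "padic_res z (Suc n) \<noteq> 0"
    unfolding n_def by (intro LeastI[of "\<lambda>n. padic_res z (Suc n) \<noteq> 0" k]) simp
  have "M \<le> n"
  proof (rule ccontr)
    assume "\<not> M \<le> n"
    then show False using padic_res_mod_le[of "Suc n" M z] assms n by simp
  qed
  moreover have "1 \<le> real CARD('p)" by (simp add: Suc_leI)
  ultimately have "(1 / real CARD('p)) ^ n \<le> (1 / real CARD('p)) ^ M"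
    by (intro power_decreasing) auto
  then show ?thesis using False by (simp add: padic_abs_def n_def)
qed (simp add: padic_abs_def)

locale padic_field =
  fixes \<iota> :: "'p::prime_card padic \<Rightarrow> 'k::field_char_0" and v :: "'k \<Rightarrow> real" and \<pi> :: 'k
    and red :: "'k \<Rightarrow> 'r::field"
  assumes hom: "field_hom \<iota>" and ext: "extends_padic_abs \<iota> v"
    and unif: "uniformizer v \<pi>" and red: "reduction_map v red"
begin

lemma v_nonneg [simp]: "v x \<ge> 0"
  and v_eq_0_iff [simp]: "v x = 0 \<longleftrightarrow> x = 0"
  and v_mult: "v (x * y) = v x * v y"
  and v_add: "v (x + y) \<le> max (v x) (v y)"
  using ext by (auto simp: extends_padic_abs_def)

lemma v_0 [simp]: "v 0 = 0"
  by simp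

lemma v_1 [simp]: "v 1 = 1"
  using v_mult[of 1 1] by simp

lemma v_uminus [simp]: "v (- x) = v x"
proof -
  have "v (- 1) * v (- 1) = 1" using v_mult[of "- 1" "- 1"] by simp
  then have "v (- 1) ^ 2 = 1 ^ 2" by (simp add: power2_eq_square)
  then have "v (- 1) = 1" using power2_eq_imp_eq[of "v (- 1)" 1] by simp
  then show ?thesis using v_mult[of "- 1" x] by simp
qed

lemma v_power: "v (x ^ n) = v x ^ n"
  by (induction n) (auto simp: v_mult)

lemma v_prod: "v (prod f A) = (\<Prod>x\<in>A. v (f x))"
  by (induction A rule: infinite_finite_induct) (auto simp: v_mult)

lemma v_divide: "v (x / y) = v x / v y"
proof (cases "y = 0")
  case False
  then have "v (x / y) * v y = v x" by (simp flip: v_mult)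
  then show ?thesis using False by (simp add: field_simps)
qed simp

section \<open>Integrality of the binomial series with p-adic exponents\<close>

definition emb :: "'p padic_int \<Rightarrow> 'k" where "emb z = \<iota> (to_fract z)"

lemma v_emb: "v (emb z) = padic_abs z"
  using ext by (simp add: extends_padic_abs_def emb_def)

lemma comm_ring_hom_emb: "comm_ring_hom emb"
proof -
  interpret \<iota>: field_hom \<iota> by (rule hom)
  show ?thesis
    by unfold_locales (auto simp: emb_def \<iota>.hom_add \<iota>.hom_mult)
qed

sublocale emb: comm_ring_hom emb by (rule comm_ring_hom_emb)

lemma v_emb_le: "padic_res z M = 0 \<Longrightarrow> v (emb z) \<le> (1 / real CARD('p)) ^ M"
  unfolding v_emb by (rule padic_abs_le)

lemma v_emb_le_1: "v (emb z) \<le> 1"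
  using v_emb_le[of z 0] padic_res_ge[of z 0] padic_res_less[of z 0] by simp

lemma v_of_nat_le_1: "v (of_nat n) \<le> 1"
  using v_emb_le_1[of "of_nat n"] by (simp add: emb.hom_of_nat)

lemma card_gt_1: "1 < real CARD('p)"
  using prime_gt_1_int[OF prime_card_int[where 'a = 'p]] by simp

lemma v_p_less_1: "v (of_nat CARD('p)) < 1"
proof -
  have "v (emb (of_nat CARD('p))) \<le> (1 / real CARD('p)) ^ 1"
    by (rule v_emb_le) (simp add: padic_res_of_nat)
  also have "\<dots> < 1" using card_gt_1 by simp
  finally show ?thesis by (simp add: emb.hom_of_nat)
qed

lemma v_falling_factorial_le: "v (\<Prod>i<n. emb z - of_nat i) \<le> v (fact n)"
proof -
  have "0 < v (fact n)" using v_nonneg[of "fact n"] v_eq_0_iff[of "fact n"] by (metis fact_nonzero less_eq_real_def)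
  then obtain M where M: "(1 / real CARD('p)) ^ M < v (fact n)"
    using real_arch_pow_inv[of "v (fact n)" "1 / real CARD('p)"] card_gt_1 by auto
  define N where "N = nat (padic_res z M)"
  let ?Q = "(\<Prod>i<n. z - of_nat i) - (\<Prod>i<n. of_nat N - of_nat i)"
  \<comment> \<open>Replacing z by N one factor at a time changes the product by a multiple of z -
    N; hence the whole error vanishes modulo p ^ M.\<close>
  have "z - of_nat N dvd (\<Prod>i<m. z - of_nat i) - (\<Prod>i<m. of_nat N - of_nat i)" for m
  proof (induction m)
    case (Suc m)
    have "(\<Prod>i<Suc m. z - of_nat i) - (\<Prod>i<Suc m. of_nat N - of_nat i)
        = ((\<Prod>i<m. z - of_nat i) - (\<Prod>i<m. of_nat N - of_nat i)) * (z - of_nat m)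
          + (z - of_nat N) * (\<Prod>i<m. of_nat N - of_nat i)"
      by (simp add: algebra_simps)
    then show ?case using Suc by simp
  qed simp
  then obtain c where c: "?Q = (z - of_nat N) * c" by (auto simp: dvd_def)
  have "padic_res (z - of_nat N) M = 0"
  proof -
    have "int N = padic_res z M" by (simp add: N_def padic_res_ge)
    then show ?thesis by (simp add: padic_res_diff padic_res_of_nat padic_res_mod)
  qed
  then have "padic_res ?Q M = 0" by (simp add: c padic_res_mult)
  then have "v (emb ?Q) \<le> v (fact n)" using v_emb_le[of ?Q M] M by linarith
  moreover have "v (\<Prod>i<n. of_nat N - of_nat i :: 'k) \<le> v (fact n)"
  proof -
    have "(\<Prod>i<n. of_nat N - of_nat i :: 'k) = fact n * of_nat (N choose n)"
      by (simp add: binomial_gbinomial gbinomial_prod_rev atLeast0LessThan)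
    then show ?thesis using v_of_nat_le_1[of "N choose n"] by (simp add: v_mult mult_left_le)
  qed
  moreover have "(\<Prod>i<n. emb z - of_nat i) = emb ?Q + (\<Prod>i<n. of_nat N - of_nat i)"
    by (simp add: emb.hom_minus emb.hom_prod emb.hom_of_nat)
  ultimately show ?thesis using v_add[of "emb ?Q" "\<Prod>i<n. of_nat N - of_nat i"] by simp
qed

lemma v_tau_le_1: "v (mps_coeff (tau \<iota> \<gamma>) m) \<le> 1"
proof -
  have "v (emb z gchoose n) \<le> 1" for z n
    using v_falling_factorial_le[of z n]
    by (simp add: gbinomial_prod_rev v_divide atLeast0LessThan divide_le_eq_1 less_le)
  then show ?thesis
    by (auto simp: tau_def v_prod emb_def intro!: prod_le_1)
qed

lemma tau_const_coeff: "mps_coeff (tau \<iota> \<gamma>) (\<lambda>_. 0) = 1"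
  by (simp add: tau_def)

section \<open>Reduction to the residue field\<close>

lemma mem_valuation_ring: "x \<in> valuation_ring v \<longleftrightarrow> v x \<le> 1"
  by (simp add: valuation_ring_def)

lemma red_1: "red 1 = 1"
  and red_add: "v x \<le> 1 \<Longrightarrow> v y \<le> 1 \<Longrightarrow> red (x + y) = red x + red y"
  and red_mult: "v x \<le> 1 \<Longrightarrow> v y \<le> 1 \<Longrightarrow> red (x * y) = red x * red y"
  and red_eq_0_iff: "v x \<le> 1 \<Longrightarrow> red x = 0 \<longleftrightarrow> v x < 1"
  using red by (auto simp: reduction_map_def mem_valuation_ring)

lemma red_0: "red 0 = 0"
  using red_eq_0_iff[of 0] by simp

lemma red_uminus: "v x \<le> 1 \<Longrightarrow> red (- x) = - red x"
  using red_add[of x "- x"] by (simp add: red_0 eq_neg_iff_add_eq_0 add.commute)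

definition red_rel :: "'k \<Rightarrow> 'r \<Rightarrow> bool" where "red_rel x y \<longleftrightarrow> v x \<le> 1 \<and> red x = y"

sublocale R: ring_rel red_rel
proof
  fix x y x' y' assume A: "red_rel x y" "red_rel x' y'"
  show "red_rel (x + x') (y + y')"
    using A v_add[of x x'] by (auto simp: red_rel_def red_add)
  show "red_rel (x * x') (y * y')"
    using A by (auto simp: red_rel_def red_mult v_mult mult_le_one)
next
  fix x y assume "red_rel x y"
  then show "red_rel (- x) (- y)" by (auto simp: red_rel_def red_uminus)
qed (auto simp: red_rel_def red_0 red_1)

lemma of_nat_p_eq_0: "of_nat CARD('p) = (0 :: 'r)"
  using R.of_nat[of "CARD('p)"] v_p_less_1 red_eq_0_iff[of "of_nat CARD('p)"]
  by (simp add: red_rel_def)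

lemma mps_rel_red_iff: "mps_rel red_rel F F' \<longleftrightarrow> integral_mps v F \<and> F' = mps_map red F"
  by (auto simp: mps_rel_def red_rel_def integral_mps_def mem_valuation_ring intro!: mps_eqI)

section \<open>Powers of the uniformizer and primitive factorizations\<close>

lemma v_pi: "0 < v \<pi>" "v \<pi> < 1"
proof -
  have *: "\<pi> \<noteq> 0" "{x. v x < 1} = {\<pi> * y | y. y \<in> valuation_ring v}"
    using unif by (auto simp: uniformizer_def)
  then show "0 < v \<pi>" by (simp add: less_le)
  have "\<pi> * 1 \<in> {\<pi> * y | y. y \<in> valuation_ring v}"
    by (intro CollectI exI[of _ 1]) (simp add: mem_valuation_ring)
  with * show "v \<pi> < 1" by auto
qed

lemma v_less_1E:
  assumes "v x < 1"
  obtains y where "x = \<pi> * y" "v y \<le> 1"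
  using assms unif by (auto simp: uniformizer_def mem_valuation_ring)

text \<open>As long as the value is below 1 a factor \<pi> can be split off; the bound v \<pi> ^ K <
  v x limits how often this happens.\<close>

lemma v_eq_power_pi:
  assumes "x \<noteq> 0" "v x \<le> 1"
  shows "\<exists>k. v x = v \<pi> ^ k"
proof -
  obtain K where "v \<pi> ^ K < v x"
    using real_arch_pow_inv[of "v x" "v \<pi>"] assms(1) v_pi(2) by (auto simp: less_le)
  then show ?thesis using assms
  proof (induction K arbitrary: x)
    case (Suc K)
    show ?case
    proof (cases "v x < 1")
      case True
      then obtain y where y: "x = \<pi> * y" "v y \<le> 1" by (rule v_less_1E)
      then have "v \<pi> ^ K < v y" using Suc.prems(1) v_pi(1) by (simp add: v_mult)
      then obtain k where "v y = v \<pi> ^ k" using Suc.IH y Suc.prems(2) by auto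
      then have "v x = v \<pi> ^ Suc k" by (simp add: y v_mult)
      then show ?thesis by blast
    next
      case False
      then show ?thesis using Suc.prems by (intro exI[of _ 0]) simp
    qed
  qed simp
qed

lemma power_v_pi_le_iff: "v \<pi> ^ k \<le> v \<pi> ^ l \<longleftrightarrow> l \<le> k"
  using v_pi by (simp add: power_decreasing_iff)

text \<open>Division by zero yields 0 in HOL, so a zero index would make every
  \<open>mu_invariant\<close> vanish. The exponent is positive because v p < 1.\<close>

lemma ramification_index_neq_0: "ramification_index CARD('p) v \<pi> \<noteq> 0"
proof -
  obtain e where e: "v (of_nat CARD('p)) = v \<pi> ^ e"
    using v_eq_power_pi[of "of_nat CARD('p)"] v_p_less_1 by auto
  have "ramification_index CARD('p) v \<pi> = e"
    unfolding ramification_index_def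
  proof (rule the_equality)
    fix e' assume "v (of_nat CARD('p)) = v \<pi> ^ e'"
    with e show "e' = e" by (metis antisym order_refl power_v_pi_le_iff)
  qed (rule e)
  moreover have "e \<noteq> 0" using e v_p_less_1 by (cases e) auto
  ultimately show ?thesis by simp
qed

lemma v_coeff_pi_mult:
  "v (mps_coeff (mps_const (\<pi> ^ n) * (F :: ('d::finite, 'k) mps)) m) = v \<pi> ^ n * v (mps_coeff F m)"
  by (simp add: mps_coeff_const_mult v_mult v_power)

lemma primitive_factorization_unique_le:
  assumes "primitive_factorization v \<pi> F N F0" "primitive_factorization v \<pi> F M F1"
  shows "M \<le> N"
proof (rule ccontr)
  assume "\<not> M \<le> N"
  \<comment> \<open>Of the surplus M - N, one power of \<pi> is set aside to contradict the
    primitivity of \<open>F0\<close>; the other k powers stay with \<open>F1\<close>.\<close>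
  define k where "k = nat (M - N - 1)"
  with \<open>\<not> M \<le> N\<close> have M: "M = N + (1 + int k)" by simp
  have pi: "\<pi> \<noteq> 0" using v_pi by auto
  have 0: "integral_mps v F1" "mps_const (\<pi> powi N) * F0 = mps_const (\<pi> powi M) * F1"
    "\<not> (\<exists>H. integral_mps v H \<and> F0 = mps_const \<pi> * H)"
    using assms by (auto simp: primitive_factorization_def)
  have "F0 = mps_const \<pi> * (mps_const (\<pi> ^ k) * F1)"
  proof (rule mps_eqI)
    fix n
    have "\<pi> powi N * mps_coeff F0 n = \<pi> powi M * mps_coeff F1 n"
      using arg_cong[OF 0(2), of "\<lambda>f. mps_coeff f n"] by (simp add: mps_coeff_const_mult)
    also have "\<pi> powi M = \<pi> powi N * (\<pi> * \<pi> ^ k)"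
      unfolding M using pi by (simp add: power_int_add)
    finally show "mps_coeff F0 n = mps_coeff (mps_const \<pi> * (mps_const (\<pi> ^ k) * F1)) n"
      using pi by (simp add: mps_coeff_const_mult)
  qed
  moreover have "integral_mps v (mps_const (\<pi> ^ k) * F1)"
    using 0(1) v_pi by (auto simp: integral_mps_def mem_valuation_ring v_coeff_pi_mult
        intro!: mult_le_one power_le_one)
  ultimately show False using 0(3) by blast
qed

lemma primitive_factorization_unique:
  assumes "primitive_factorization v \<pi> F N F0" "primitive_factorization v \<pi> F M F1"
  shows "M = N" "F1 = F0"
proof -
  show MN: "M = N"
    using primitive_factorization_unique_le[OF assms] primitive_factorization_unique_le[OF assms(2,1)] by simp
  have pi: "\<pi> \<noteq> 0" using v_pi by auto
  have eq: "mps_const (\<pi> powi N) * F1 = mps_const (\<pi> powi N) * F0"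
    using assms MN by (auto simp: primitive_factorization_def)
  show "F1 = F0"
    by (rule mps_eqI) (use eq pi in \<open>metis mps_coeff_const_mult mult_left_cancel power_int_not_zero\<close>)
qed

text \<open>The maximal ideal is generated by \<pi>, so zero reduction allows \<pi> to be divided
  out of each coefficient separately. This translates primitivity into nonzero reduction.\<close>

lemma divisible_by_pi_iff:
  fixes F :: "('d::finite, 'k) mps"
  assumes "integral_mps v F"
  shows "(\<exists>H. integral_mps v H \<and> F = mps_const \<pi> * H) \<longleftrightarrow> mps_map red F = 0"
proof
  assume "\<exists>H. integral_mps v H \<and> F = mps_const \<pi> * H"
  then obtain H where H: "integral_mps v H" "F = mps_const \<pi> * H" by blast
  show "mps_map red F = 0"
  proof (rule mps_eqI)
    fix n
    have "v (mps_coeff H n) \<le> 1" using H(1) by (simp add: integral_mps_def mem_valuation_ring)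
    then have "v \<pi> * v (mps_coeff H n) \<le> v \<pi> * 1" using v_pi by (intro mult_left_mono) auto
    then have "v (mps_coeff F n) < 1" using H(2) v_pi(2) by (simp add: mps_coeff_const_mult v_mult)
    then show "mps_coeff (mps_map red F) n = mps_coeff 0 n" by (simp add: red_eq_0_iff)
  qed
next
  assume red0: "mps_map red F = 0"
  have "\<exists>y. mps_coeff F n = \<pi> * y \<and> v y \<le> 1" for n
  proof -
    have "red (mps_coeff F n) = 0" using arg_cong[OF red0, of "\<lambda>f. mps_coeff f n"] by simp
    then have "v (mps_coeff F n) < 1"
      using assms by (subst (asm) red_eq_0_iff) (auto simp: integral_mps_def mem_valuation_ring)
    then show ?thesis using v_less_1E by blast
  qed
  then obtain h where h: "\<And>n. mps_coeff F n = \<pi> * h n \<and> v (h n) \<le> 1" by metis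
  then have "integral_mps v (Abs_mps h)" "F = mps_const \<pi> * Abs_mps h"
    by (auto simp: integral_mps_def mem_valuation_ring mps_coeff_const_mult intro!: mps_eqI)
  then show "\<exists>H. integral_mps v H \<and> F = mps_const \<pi> * H" by blast
qed

lemma primitive_factorization_integral:
  fixes F :: "('d::finite, 'k) mps"
  assumes "integral_mps v F" "mps_map red F \<noteq> 0"
  shows "primitive_factorization v \<pi> F 0 F"
proof -
  have "F = mps_const (\<pi> powi 0) * F" by (rule mps_eqI) (simp add: mps_coeff_const_mult)
  then show ?thesis using assms divisible_by_pi_iff by (auto simp: primitive_factorization_def)
qed

text \<open>The exponent is the greatest m with \<pi> ^ m dividing \<open>F\<close>. The value of
  any nonzero coefficient bounds it, and the vanishing reduction makes it at least 1.\<close>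

lemma ex_primitive_factorization:
  fixes F :: "('d::finite, 'k) mps"
  assumes F: "integral_mps v F" "F \<noteq> 0" and red0: "mps_map red F = 0"
  shows "\<exists>N F0. N \<noteq> 0 \<and> primitive_factorization v \<pi> F N F0"
proof -
  define P where "P m \<longleftrightarrow> (\<exists>H. integral_mps v H \<and> F = mps_const (\<pi> ^ m) * H)" for m
  obtain n where n: "mps_coeff F n \<noteq> 0" using F(2) by (metis mps_eqI mps_coeff_0)
  have "v (mps_coeff F n) \<le> 1" using F(1) by (simp add: integral_mps_def mem_valuation_ring)
  then obtain k where k: "v (mps_coeff F n) = v \<pi> ^ k" using v_eq_power_pi n by blast
  have bound: "m \<le> k" if P: "P m" for m
  proof -
    obtain H where H: "integral_mps v H" "F = mps_const (\<pi> ^ m) * H" using P by (auto simp: P_def)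
    have "v (mps_coeff H n) \<le> 1" using H(1) by (simp add: integral_mps_def mem_valuation_ring)
    then have "v \<pi> ^ m * v (mps_coeff H n) \<le> v \<pi> ^ m"
      by (intro mult_left_le) auto
    then have "v \<pi> ^ k \<le> v \<pi> ^ m"
      using k H(2) v_coeff_pi_mult[of m H n] by simp
    then show ?thesis by (simp add: power_v_pi_le_iff)
  qed
  have P1: "P 1" using red0 divisible_by_pi_iff[OF F(1)] by (simp add: P_def)
  define m where "m = (GREATEST m. P m)"
  have m: "P m" "1 \<le> m" and not: "\<not> P (Suc m)"
    using GreatestI_nat[of P 1 k] Greatest_le_nat[of P _ k] P1 bound unfolding m_def
    by (blast, blast, meson Suc_n_not_le_n)
  have "\<exists>H. integral_mps v H \<and> F = mps_const (\<pi> ^ m) * H"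
    using m(1) by (simp only: P_def)
  then obtain H where H: "integral_mps v H" "F = mps_const (\<pi> ^ m) * H" by blast
  have "\<not> (\<exists>H'. integral_mps v H' \<and> H = mps_const \<pi> * H')"
  proof
    assume "\<exists>H'. integral_mps v H' \<and> H = mps_const \<pi> * H'"
    then obtain H' where H': "integral_mps v H'" "H = mps_const \<pi> * H'" by blast
    have "F = mps_const (\<pi> ^ Suc m) * H'"
      unfolding H(2) H'(2) by (rule mps_eqI, simp only: mps_coeff_const_mult, simp)
    then show False using H'(1) not by (auto simp: P_def)
  qed
  then have "primitive_factorization v \<pi> F (int m) H"
    using H by (simp add: primitive_factorization_def)
  then show ?thesis using m(2) by (intro exI[of _ "int m"] exI[of _ H]) auto
qed

lemma mu_invariant_eq_0_iff:
  fixes F :: "('d::finite, 'k) mps"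
  assumes "integral_mps v F" "F \<noteq> 0"
  shows "mu_invariant CARD('p) v \<pi> F = 0 \<longleftrightarrow> mps_map red F \<noteq> 0"
proof -
  have the: "(THE N. \<exists>F0. primitive_factorization v \<pi> F N F0) = N"
    if "primitive_factorization v \<pi> F N F0" for N F0
    using that primitive_factorization_unique(1) by (intro the_equality) blast+
  show ?thesis
  proof (cases "mps_map red F = 0")
    case True
    then obtain N F0 where "N \<noteq> 0" "primitive_factorization v \<pi> F N F0"
      using ex_primitive_factorization assms by blast
    then show ?thesis using the True ramification_index_neq_0 by (simp add: mu_invariant_def)
  next
    case False
    then show ?thesis using the[OF primitive_factorization_integral] assms
      by (simp add: mu_invariant_def)
  qed
qed

lemma primitive_part_integral:
  fixes F :: "('d::finite, 'k) mps"
  assumes "integral_mps v F" "mps_map red F \<noteq> 0"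
  shows "primitive_part v \<pi> F = F"
  unfolding primitive_part_def
  using primitive_factorization_integral[OF assms] primitive_factorization_unique(2)
  by (intro the_equality) blast+

end

section \<open>The lambda-invariant of a power and the reduction of the resultant\<close>

context padic_field
begin

text \<open>Both series are their own primitive parts. A prime contains f ^ q exactly when it
  contains f, so the two sums have the same index set, and each order is multiplied by q. The
  generators have no constant term because \<open>tau\<close> has constant coefficient 1.\<close>

lemma lambda_invariant_power:
  fixes F F' :: "('d::finite, 'k) mps"
  assumes F: "integral_mps v F" "mps_map red F \<noteq> 0" and F': "integral_mps v F'"
    and eq: "mps_map red F' = mps_map red F ^ q" and q: "q > 0"
  shows "lambda_invariant \<iota> v \<pi> red F' = q * lambda_invariant \<iota> v \<pi> red F"
proof -
  define f where "f = mps_map red F"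
  have f: "f \<noteq> 0" using F by (simp add: f_def)
  have parts: "mps_map red (primitive_part v \<pi> F) = f" "mps_map red (primitive_part v \<pi> F') = f ^ q"
    using F F' eq f by (simp_all add: primitive_part_integral f_def)
  define Q where "Q f = {I. height_one_prime I \<and> f \<in> I
     \<and> (\<exists>\<sigma> :: 'd \<Rightarrow> 'p padic_int. \<not> (\<exists>\<gamma>. \<forall>i. \<sigma> i = of_nat CARD('p) * \<gamma> i)
        \<and> I = PIdl\<^bsub>ring_of_type_algebra\<^esub> (mps_map red (tau \<iota> \<sigma> - 1)))}" for f :: "('d, 'r) mps"
  have lam: "lambda_invariant \<iota> v \<pi> red F = (\<Sum>I\<in>Q f. ord_at I f)"
    "lambda_invariant \<iota> v \<pi> red F' = (\<Sum>I\<in>Q (f ^ q). ord_at I (f ^ q))"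
    by (simp_all only: lambda_invariant_def Let_def parts Q_def)
  have "Q (f ^ q) = Q f"
    using primeideal_power_mem_iff[OF _ q] by (auto simp: Q_def height_one_prime_def)
  moreover have "ord_at I (f ^ q) = q * ord_at I f" if I: "I \<in> Q f" for I
  proof -
    obtain \<sigma> :: "'d \<Rightarrow> 'p padic_int" where "I = PIdl\<^bsub>ring_of_type_algebra\<^esub> (mps_map red (tau \<iota> \<sigma> - 1))"
      using I by (auto simp: Q_def)
    moreover have "mps_coeff (mps_map red (tau \<iota> \<sigma> - 1)) (\<lambda>_. 0) = 0"
      by (simp add: tau_const_coeff mps_coeff_1 red_0)
    moreover have "primeideal I ring_of_type_algebra" "I \<noteq> {0}"
      using I by (auto simp: Q_def height_one_prime_def)
    ultimately show ?thesis using ord_at_power f q by blast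
  qed
  ultimately show ?thesis by (simp add: lam sum_distrib_left)
qed

text \<open>Monicity of both arguments of the resultant preserves their degrees, so the Sylvester
  matrix over K reduces entry by entry to the one over the residue field.\<close>

lemma resultant_series_reduction:
  fixes \<alpha> :: "'e \<Rightarrow> 'd::finite \<Rightarrow> 'p padic_int" and w :: "'e \<Rightarrow> 'k"
  assumes V: "finite (verts Z)"
    and W: "\<And>e. e \<in> arcs Z \<Longrightarrow> mps_rel red_rel (mps_const (w e) * tau \<iota> (\<alpha> e)) (W e)"
    and D: "\<And>x. x \<in> verts Z \<Longrightarrow> mps_rel red_rel (mps_const (\<Sum>e\<in>out_arcs Z x. w e)) (D x)"
    and P: "lead_coeff P = 1" "\<And>i. v (coeff P i) \<le> 1"
  shows "lead_coeff (det_on (verts Z) (spectral_matrix Z W D)) = 1"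
    and "integral_mps v (resultant_series \<iota> Z w \<alpha> P)"
    and "mps_map red (resultant_series \<iota> Z w \<alpha> P)
      = resultant (det_on (verts Z) (spectral_matrix Z W D)) (map_poly (\<lambda>c. mps_const (red c)) P)"
proof -
  let ?S = "mps_rel red_rel :: ('d, 'k) mps \<Rightarrow> ('d, 'r) mps \<Rightarrow> bool"
  let ?D = "\<lambda>x. mps_const (\<Sum>e\<in>out_arcs Z x. w e) :: ('d, 'k) mps"
  interpret M: ring_rel ?S by (rule R.ring_rel_mps)
  interpret MP: ring_rel "poly_rel ?S" by (rule M.ring_rel_poly)
  have S01: "?S 0 y \<Longrightarrow> y = 0" "?S 1 y \<Longrightarrow> y = 1" for y
    using M.zero M.one unfolding mps_rel_red_iff by auto
  let ?F = "spectral_poly \<iota> Z w \<alpha>" and ?F' = "det_on (verts Z) (spectral_matrix Z W D)"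
  have F: "poly_rel ?S ?F ?F'"
    unfolding spectral_poly_eq
    by (intro MP.det_on M.spectral_matrix W D)
  have Fm: "lead_coeff ?F = 1"
    unfolding spectral_poly_eq by (rule det_on_spectral_matrix_monic[OF V])
  show "lead_coeff ?F' = 1" by (rule M.poly_rel_degree(2)[OF F Fm S01])
  let ?P = "map_poly mps_const P :: ('d, 'k) mps poly"
  let ?P' = "map_poly (\<lambda>c. mps_const (red c)) P :: ('d, 'r) mps poly"
  have c0: "mps_const 0 = (0 :: ('d, 'k) mps)" "mps_const (red 0) = (0 :: ('d, 'r) mps)"
    "mps_const 1 = (1 :: ('d, 'k) mps)"
    by (auto intro!: mps_eqI simp: mps_coeff_const mps_coeff_1 red_0)
  have P': "poly_rel ?S ?P ?P'"
    using P(2) by (auto simp: poly_rel_def coeff_map_poly c0 intro!: R.mps_rel_const) (simp add: red_rel_def)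
  have Pm: "lead_coeff ?P = 1"
  proof -
    have "degree ?P = degree P"
      using P(1) c0(3) by (intro degree_map_poly) auto
    then show ?thesis using P(1) by (simp add: coeff_map_poly c0)
  qed
  have "?S (resultant ?F ?P) (resultant ?F' ?P')"
    using F P' M.poly_rel_degree(1)[OF F Fm S01] M.poly_rel_degree(1)[OF P' Pm S01]
    by (intro M.resultant) (auto simp: poly_rel_def)
  then show "integral_mps v (resultant_series \<iota> Z w \<alpha> P)"
    "mps_map red (resultant_series \<iota> Z w \<alpha> P) = resultant ?F' ?P'"
    unfolding mps_rel_red_iff resultant_series_def by auto
qed

end

theorem theorem5p3:
  fixes \<iota> :: "'p::prime_card padic \<Rightarrow> 'k::field_char_0"
    and v :: "'k \<Rightarrow> real" and \<pi> :: 'k and red :: "'k \<Rightarrow> 'r::field"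
    and \<X> :: "('v, 'e) pre_digraph" and arev :: "'e \<Rightarrow> 'e"
    and \<alpha> :: "'e \<Rightarrow> 'd::finite \<Rightarrow> 'p padic_int"
    and G :: "('g, 'm) monoid_scheme" and \<beta> :: "'e \<Rightarrow> 'g"
    and \<Y> :: "('v \<times> 'g, 'e \<times> 'g) pre_digraph"
    and w :: "'e \<Rightarrow> 'k" and P :: "'k poly"
    and R_X R_Y :: "('d, 'k) mps"
  assumes "finite_extension_Qp \<iota>" and "extends_padic_abs \<iota> v"
    and "uniformizer v \<pi>" and "reduction_map v red"
    and "finite_symmetric_digraph \<X> arev" and "connected \<X>"
    and "\<forall>x\<in>verts \<X>. out_degree \<X> x \<ge> 1"
    and "voltage_assignment \<X> arev \<alpha>"
    and "group G" and "finite (carrier G)" and "\<exists>n. card (carrier G) = CARD('p) ^ n"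
    and "splitting_field TYPE('k) G"
    and "group_voltage \<X> arev G \<beta>"
    and "\<Y> = derived_digraph \<X> G \<beta>" and "connected \<Y>"
    and "w = grover_weight \<X>"
    and "\<forall>e\<in>arcs \<X>. w e \<in> valuation_ring v"
    and "lead_coeff P = 1" and "\<forall>i. coeff P i \<in> valuation_ring v"
    and "R_X = resultant_series \<iota> \<X> w \<alpha> P"
    and "R_Y = resultant_series \<iota> \<Y> (w \<circ> fst) (\<alpha> \<circ> fst) P"
    and "R_X \<noteq> 0" and "R_Y \<noteq> 0"
  shows "(mu_invariant CARD('p) v \<pi> R_X = 0 \<longleftrightarrow> mu_invariant CARD('p) v \<pi> R_Y = 0)
    \<and> (mu_invariant CARD('p) v \<pi> R_X = 0 \<longrightarrow>
         lambda_invariant \<iota> v \<pi> red R_Y = card (carrier G) * lambda_invariant \<iota> v \<pi> red R_X)"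
proof -
  interpret padic_field \<iota> v \<pi> red
    using assms(1-4) by (auto simp: finite_extension_Qp_def intro: padic_field.intro)
  interpret X: fin_digraph \<X> using assms(5) by (simp add: finite_symmetric_digraph_def)
  interpret M: ring_rel "mps_rel red_rel :: ('d, 'k) mps \<Rightarrow> ('d, 'r) mps \<Rightarrow> bool"
    by (rule R.ring_rel_mps)
  have \<beta>: "\<beta> e \<in> carrier G" if "e \<in> arcs \<X>" for e
    using assms(13) that by (auto simp: group_voltage_def)
  have w: "red_rel (w e) (red (w e))" if "e \<in> arcs \<X>" for e
    using assms(17) that by (auto simp: red_rel_def mem_valuation_ring)
  have P: "v (coeff P i) \<le> 1" for i using assms(19) by (auto simp: mem_valuation_ring)
  define W where "W e = mps_const (red (w e)) * mps_map red (tau \<iota> (\<alpha> e))" for e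
  define D where "D x = (mps_const (\<Sum>e\<in>out_arcs \<X> x. red (w e)) :: ('d, 'r) mps)" for x
  have W: "mps_rel red_rel (mps_const (w e) * tau \<iota> (\<alpha> e)) (W e)" if "e \<in> arcs \<X>" for e
    unfolding W_def
    by (intro M.mult R.mps_rel_const w that) (simp add: mps_rel_def red_rel_def v_tau_le_1)
  have D: "mps_rel red_rel (mps_const (\<Sum>e\<in>out_arcs \<X> x. w e)) (D x)" for x
    unfolding D_def by (intro R.mps_rel_const R.sum w) auto
  \<comment> \<open>The covering map is a bijection from the arcs leaving a vertex of the cover to
    those leaving its image, so the diagonal terms are pulled back as well.\<close>
  have out: "(\<Sum>e\<in>out_arcs \<Y> z. (w \<circ> fst) e) = (\<Sum>e\<in>out_arcs \<X> (fst z). w e)" if "z \<in> verts \<Y>" for z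
    using that unfolding assms(14) out_arcs_def derived_digraph_def
    by (intro sum.reindex_bij_witness[where i = "\<lambda>e. (e, snd z)" and j = fst]) auto
  define q where "q = card (carrier G)"
  interpret G: group G by fact
  have q: "q > 0" using assms(10) by (auto simp: q_def card_gt_0_iff)
  let ?FX = "det_on (verts \<X>) (spectral_matrix \<X> W D)"
  let ?FY = "det_on (verts \<Y>) (spectral_matrix \<Y> (W \<circ> fst) (D \<circ> fst))"
  let ?P = "map_poly (\<lambda>c. mps_const (red c)) P :: ('d, 'r) mps poly"
  have vertsY: "finite (verts \<Y>)" using assms(10) by (simp add: assms(14) derived_digraph_def)
  note RX = resultant_series_reduction[OF X.finite_verts W D assms(18) P, folded assms(20)]
  have WY: "mps_rel red_rel (mps_const ((w \<circ> fst) e) * tau \<iota> ((\<alpha> \<circ> fst) e)) ((W \<circ> fst) e)"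
    if "e \<in> arcs \<Y>" for e
    using W[of "fst e"] that by (auto simp: assms(14) derived_digraph_def)
  have DY: "mps_rel red_rel (mps_const (\<Sum>e\<in>out_arcs \<Y> z. (w \<circ> fst) e)) ((D \<circ> fst) z)"
    if "z \<in> verts \<Y>" for z
    using D[of "fst z"] out[OF that] by simp
  note RY = resultant_series_reduction[OF vertsY WY DY assms(18) P, folded assms(21)]
  obtain n where n: "card (carrier G) = CARD('p) ^ n" using assms(11) by blast
  have FY: "?FY = ?FX ^ q"
    unfolding assms(14) q_def
    by (rule det_on_spectral_matrix_derived[OF X.fin_digraph_axioms assms(9,10) n prime_card of_nat_p_eq_0 \<beta>])
  have red_eq: "mps_map red R_Y = mps_map red R_X ^ q"
  proof -
    have "mps_map red R_Y = resultant ?FY ?P" by (rule RY(3))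
    also have "\<dots> = resultant ?FX ?P ^ q"
      unfolding FY by (rule resultant_power_monic_left[OF RX(1)])
    also have "resultant ?FX ?P = mps_map red R_X" by (rule RX(3)[symmetric])
    finally show ?thesis .
  qed
  have mu: "mu_invariant CARD('p) v \<pi> R_X = 0 \<longleftrightarrow> mps_map red R_X \<noteq> 0"
    "mu_invariant CARD('p) v \<pi> R_Y = 0 \<longleftrightarrow> mps_map red R_X \<noteq> 0"
    using mu_invariant_eq_0_iff[OF RX(2) assms(22)] mu_invariant_eq_0_iff[OF RY(2) assms(23)] q
    by (simp_all add: red_eq)
  show ?thesis
    using mu lambda_invariant_power[OF RX(2) _ RY(2) red_eq q] by (simp add: q_def)
qed

end
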